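(* Let $k$ be a field of characteristic zero and let $B$ be an affine UFD over $k$ which admits a nontrivial fundamental pair $(D,U)$ such that $A_0\ne k$ and $A\cong k^{[2]}$, where $A=\ker D$ and $A_0=A\cap\ker U$. Then either (1) $B=k[X,Y,Z]=k^{[3]}$ and $(D,U)$ is equivalent to $\left(Y\frac{\partial}{\partial Z},\, Z\frac{\partial}{\partial Y}\right)$; or (2) $B=k[X,Y,Z,W]/(2XZ-Y^2-P(W))$ for some $P(T)\in k[T]\cong k^{[1]}$, and $(D,U)$ is equivalent to the fundamental pair induced by $(X\partial_Y+Y\partial_Z,\; 2Y\partial_X+2Z\partial_Y)$ on $k[X,Y,Z,W]=k^{[4]}$. In addition, $ML(B)=k$.
   Context: $k^{[n]}$ is the polynomial ring in $n$ variables over $k$. An affine UFD over $k$ is a unique factorization domain containing $k$ and finitely generated as a $k$-algebra. ${\rm LND}(B)$ is the set of locally nilpotent derivations of $B$ (for each $b\in B$ there is $n\ge 0$ with $D^nb=0$). The Makar-Limanov invariant $ML(B)$ is the intersection of the kernels of all locally nilpotent derivations of $B$. A pair $(D,U)\in{\rm LND}(B)^2$ is a fundamental pair for $B$ if (1) $[D,[D,U]]=-2D$ and $[U,[D,U]]=2U$; and (2) $B=\sum_{d\in\mathbb{Z}}B_d$ where $B_d=\ker([D,U]-dI)$. It is trivial if $D=U=0$ and nontrivial otherwise. Two fundamental pairs on $B$ are equivalent if they lie in the same orbit under the transformations $(D,U)\mapsto(U,D)$, $(D,U)\mapsto(rD,r^{-1}U)$ for $r\in B^*$, and $(D,U)\mapsto(\alpha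 D\alpha^{-1},\alpha U\alpha^{-1})$ for $\alpha\in{\rm Aut}_k(B)$. The equalities for $B$ in (1) and (2) are understood up to $k$-algebra isomorphism. *)

theory Defs
  imports
    "HOL-Algebra.Algebraic_Closure_Type"
    "HOL-Algebra.Generated_Rings"
    "HOL-Algebra.QuotRing"
    "HOL-Computational_Algebra.Polynomial"
    "HOL-Library.Poly_Mapping"
    "HOL-Library.Numeral_Type"
begin

text \<open>
  The field \<open>k\<close> and the \<open>k\<close>-algebra \<open>B\<close> are types, the algebra structure being a ring
  homomorphism \<open>i :: 'k \<Rightarrow> 'b\<close>.  Since kernels of derivations and quotients of polynomial rings are
  not types, statements about them use HOL-Algebra; \<^const>\<open>ring_of_type_algebra\<close> is the ring
  structure of a type.
\<close>

abbreviation type_ring :: "'a::ring_1 ring" where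
  "type_ring \<equiv> ring_of_type_algebra"


subsection \<open>Algebras over a field\<close>

definition affine_UFD :: "('k::field \<Rightarrow> 'b::idom) \<Rightarrow> bool" where
  "affine_UFD i \<longleftrightarrow>
     i \<in> ring_hom type_ring type_ring \<and>
     factorial_domain (type_ring :: 'b ring) \<and>
     (\<exists>S. finite S \<and> generate_ring type_ring (range i \<union> S) = UNIV)"

text \<open>\<open>s\<close> and \<open>t\<close> are the structure maps of the \<open>k\<close>-algebras \<open>S\<close> and \<open>T\<close>.\<close>

definition alg_iso ::
  "'a ring \<Rightarrow> ('k::field \<Rightarrow> 'a) \<Rightarrow> 'b ring \<Rightarrow> ('k \<Rightarrow> 'b) \<Rightarrow> ('a \<Rightarrow> 'b) set" where
  "alg_iso S s T t = {h \<in> ring_iso S T. \<forall>c. h (s c) = t c}"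

definition algebra_aut :: "('k::field \<Rightarrow> 'b::idom) \<Rightarrow> ('b \<Rightarrow> 'b) set" where
  "algebra_aut i = alg_iso type_ring i type_ring i"


subsection \<open>Polynomial rings\<close>

text \<open>
  The polynomial ring in the variables indexed by a finite type \<open>'n\<close>; it is \<open>k\<^sup>[\<^sup>n\<^sup>]\<close>
  for the numeral type \<open>n\<close>, whose elements are \<open>0, \<dots>, n - 1\<close>.
\<close>

type_synonym ('n, 'k) mpol = "('n \<Rightarrow>\<^sub>0 nat) \<Rightarrow>\<^sub>0 'k"

definition Const :: "'k::field \<Rightarrow> ('n, 'k) mpol" where
  "Const c = Poly_Mapping.single 0 c"

definition Var :: "'n \<Rightarrow> ('n, 'k::field) mpol" where
  "Var v = Poly_Mapping.single (Poly_Mapping.single v 1) 1"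

text \<open>
  If \<open>v\<close> does not occur in the monomial \<open>m\<close>, the truncated exponent \<open>m - single v 1\<close> is
  harmless because the coefficient vanishes.
\<close>

definition partial :: "'n \<Rightarrow> ('n, 'k::field) mpol \<Rightarrow> ('n, 'k) mpol" where
  "partial v p = (\<Sum>m\<in>Poly_Mapping.keys p.
     Poly_Mapping.single (m - Poly_Mapping.single v 1)
       (of_nat (Poly_Mapping.lookup m v) * Poly_Mapping.lookup p m))"


subsection \<open>Locally nilpotent derivations and fundamental pairs\<close>

text \<open>
  Derivations are not required to be \<open>k\<close>-linear: on a domain of characteristic zero, locally
  nilpotent derivations vanish on all units, hence on \<open>k\<close>.
\<close>

definition derivation :: "('b::comm_ring_1 \<Rightarrow> 'b) \<Rightarrow> bool" where
  "derivation D \<longleftrightarrow> (\<forall>a b. D (a + b) = D a + D b) \<and> (\<forall>a b. D (a * b) = a * D b + D a * b)"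

definition LND :: "('b::comm_ring_1 \<Rightarrow> 'b) set" where
  "LND = {D. derivation D \<and> (\<forall>b. \<exists>n. (D ^^ n) b = 0)}"

definition Ker :: "('b \<Rightarrow> 'b::zero) \<Rightarrow> 'b set" where
  "Ker D = {b. D b = 0}"

definition makar_limanov :: "'b::comm_ring_1 set" where
  "makar_limanov = (\<Inter>D\<in>LND. Ker D)"

definition commutator :: "('b \<Rightarrow> 'b) \<Rightarrow> ('b \<Rightarrow> 'b) \<Rightarrow> 'b::comm_ring_1 \<Rightarrow> 'b" where
  "commutator D U = (\<lambda>b. D (U b) - U (D b))"

definition weight_space :: "('b \<Rightarrow> 'b) \<Rightarrow> ('b \<Rightarrow> 'b) \<Rightarrow> int \<Rightarrow> 'b::comm_ring_1 set" where
  "weight_space D U d = Ker (\<lambda>b. commutator D U b - of_int d * b)"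

definition fundamental_pair :: "('b::comm_ring_1 \<Rightarrow> 'b) \<Rightarrow> ('b \<Rightarrow> 'b) \<Rightarrow> bool" where
  "fundamental_pair D U \<longleftrightarrow>
     D \<in> LND \<and> U \<in> LND \<and>
     commutator D (commutator D U) = (\<lambda>b. - 2 * D b) \<and>
     commutator U (commutator D U) = (\<lambda>b. 2 * U b) \<and>
     (\<forall>b. \<exists>S f. finite S \<and> (\<forall>d\<in>S. f d \<in> weight_space D U d) \<and> b = (\<Sum>d\<in>S. f d))"

definition trivial_pair :: "('b \<Rightarrow> 'b) \<Rightarrow> ('b \<Rightarrow> 'b::zero) \<Rightarrow> bool" where
  "trivial_pair D U \<longleftrightarrow> D = (\<lambda>_. 0) \<and> U = (\<lambda>_. 0)"

inductive pair_step ::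
  "('k::field \<Rightarrow> 'b::idom) \<Rightarrow> ('b \<Rightarrow> 'b) \<times> ('b \<Rightarrow> 'b) \<Rightarrow> ('b \<Rightarrow> 'b) \<times> ('b \<Rightarrow> 'b) \<Rightarrow> bool"
  for i :: "'k \<Rightarrow> 'b" where
  swap: "pair_step i (D, U) (U, D)"
| scale: "r * s = 1 \<Longrightarrow> pair_step i (D, U) (\<lambda>b. r * D b, \<lambda>b. s * U b)"
| conjugate: "\<alpha> \<in> algebra_aut i \<Longrightarrow>
    pair_step i (D, U) (\<alpha> \<circ> D \<circ> inv_into UNIV \<alpha>, \<alpha> \<circ> U \<circ> inv_into UNIV \<alpha>)"

text \<open>Each transformation is invertible by one of the same kind, so orbits are the classes of
  the generated equivalence relation.\<close>

definition pair_equiv ::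
  "('k::field \<Rightarrow> 'b::idom) \<Rightarrow> ('b \<Rightarrow> 'b) \<times> ('b \<Rightarrow> 'b) \<Rightarrow> ('b \<Rightarrow> 'b) \<times> ('b \<Rightarrow> 'b) \<Rightarrow> bool" where
  "pair_equiv i = equivclp (pair_step i)"


subsection \<open>The model pairs\<close>

text \<open>The map on \<open>B\<close> corresponding to a self-map \<open>F\<close> of \<open>S\<close> under an isomorphism \<open>h\<close> from \<open>S\<close>
  onto \<open>B\<close>.\<close>

definition transport :: "'a ring \<Rightarrow> ('a \<Rightarrow> 'b) \<Rightarrow> ('a \<Rightarrow> 'a) \<Rightarrow> 'b \<Rightarrow> 'b" where
  "transport S h F = h \<circ> F \<circ> inv_into (carrier S) h"

text \<open>The map induced by \<open>F\<close> on the cosets of \<open>I\<close>: if \<open>F\<close> is additive and preserves \<open>I\<close>, all sets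
  in the union are equal, and the coset of \<open>p\<close> is mapped to that of \<open>F p\<close>.\<close>

definition induced :: "'a::comm_ring_1 set \<Rightarrow> ('a \<Rightarrow> 'a) \<Rightarrow> 'a set \<Rightarrow> 'a set" where
  "induced I F C = (\<Union>p\<in>C. I +>\<^bsub>type_ring\<^esub> F p)"

text \<open>The variables \<open>X, Y, Z\<close> (and \<open>W\<close>) are numbered \<open>0, 1, 2\<close> (and \<open>3\<close>).\<close>

definition D3 :: "(3, 'k::field) mpol \<Rightarrow> (3, 'k) mpol" where
  "D3 p = Var 1 * partial 2 p"

definition U3 :: "(3, 'k::field) mpol \<Rightarrow> (3, 'k) mpol" where
  "U3 p = Var 2 * partial 1 p"

definition D4 :: "(4, 'k::field) mpol \<Rightarrow> (4, 'k) mpol" where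
  "D4 p = Var 0 * partial 1 p + Var 1 * partial 2 p"

definition U4 :: "(4, 'k::field) mpol \<Rightarrow> (4, 'k) mpol" where
  "U4 p = 2 * Var 1 * partial 0 p + 2 * Var 2 * partial 1 p"

definition relation_ideal :: "'k::field poly \<Rightarrow> (4, 'k) mpol set" where
  "relation_ideal P =
     PIdl\<^bsub>type_ring\<^esub> (2 * Var 0 * Var 2 - Var 1 ^ 2 - poly (map_poly Const P) (Var 3))"

definition model_ring :: "'k::field poly \<Rightarrow> (4, 'k) mpol set ring" where
  "model_ring P = type_ring Quot relation_ideal P"

definition model_const :: "'k::field poly \<Rightarrow> 'k \<Rightarrow> (4, 'k) mpol set" where
  "model_const P c = relation_ideal P +>\<^bsub>type_ring\<^esub> Const c"

end

theory Submission
  imports Defs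
begin

text \<open>
  Let \<open>H = [D, U]\<close>.  The relations between \<open>D\<close>, \<open>H\<close> and \<open>U\<close> are those of \<open>sl\<^sub>2\<close>: the eigenspaces
  of \<open>H\<close> form a grading of \<open>B\<close> by weights, \<open>D\<close> raises weights by 2 and \<open>U\<close> lowers them by 2.  As in
  the representation theory of \<open>sl\<^sub>2\<close>, the elements of \<open>A = ker D\<close> have weights \<open>\<ge> 0\<close>, the elements
  of weight 0 in \<open>A\<close> form \<open>A\<^sub>0\<close>, and every \<open>U\<close>-stable subspace that contains \<open>A\<close> is all
  of \<open>B\<close> (\<open>U_stable_span_of_kernel\<close>).

  The first main step is that \<open>A = k[p, q]\<close> with \<open>A\<^sub>0 = k[p]\<close> and with \<open>q\<close> homogeneous of some
  weight \<open>e > 0\<close> and prime in \<open>B\<close> (\<open>graded_coordinates\<close>, \<open>graded_plane_exists\<close>).  Projection to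
  weight 0 is a retraction of \<open>A \<cong> k\<^sup>[\<^sup>2\<^sup>]\<close> onto \<open>A\<^sub>0\<close>.  The self-map of the plane \<open>Spec A\<close> that it
  induces is idempotent, so it fixes the image of the origin.  Let the two coordinates be centred
  at this fixed point.  Then their components of weight 0 generate the maximal ideal of the point
  in \<open>A\<^sub>0\<close>, and their components of positive weight together generate the kernel \<open>I\<close> of the retraction.
  The cotangent plane of \<open>A\<close> at the point is graded.  It is neither entirely of weight 0 nor
  entirely of positive weight, since by Nakayama's lemma this would force \<open>I = 0\<close> or \<open>A\<^sub>0 = k\<close>.
  So one cotangent direction is represented by an invariant \<open>w\<close> and the other by a homogeneous
  \<open>x\<close> of positive weight.  Unique factorization provides prime factors \<open>p\<close> of \<open>w\<close> and \<open>q\<close> of \<open>x\<close>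
  that vanish at the point, and Nakayama's lemma modulo such a prime shows that they generate the
  two ideals.  Induction on the degree and on the weight then yields \<open>A\<^sub>0 = k[p]\<close> and \<open>A = A\<^sub>0[q]\<close>.

  The second main step is \<open>e \<le> 2\<close> (\<open>e_le_2\<close>).  With \<open>y = U q\<close> and \<open>z = U y\<close>, the element
  \<open>(e - 1) y\<^sup>2 - e q z\<close> lies in \<open>A\<close> and has weight \<open>2 e - 4\<close>.  If this is positive, then \<open>q\<close> divides the
  element, hence \<open>y\<^sup>2\<close> and \<open>y\<close>; but \<open>t = y / q\<close> would have weight \<open>-2\<close> and \<open>D t = e \<noteq> 0\<close>, which
  \<open>sl\<^sub>2\<close> theory forbids.

  If \<open>e = 1\<close>, then \<open>B = k[p, q, U q]\<close>.  If \<open>e = 2\<close>, then \<open>B\<close> is generated by \<open>p\<close>, \<open>q\<close>, \<open>y = U q / 2\<close>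
  and \<open>z = U y / 2\<close>, and \<open>2 q z - y\<^sup>2\<close> is an invariant, that is, a polynomial \<open>P(p)\<close>.  Comparing degrees
  with respect to \<open>D\<close> shows that there are no further relations.  In both cases the isomorphism with
  the model carries the model pair exactly to \<open>(D, U)\<close>.  Finally, an element killed by \<open>D\<close> and
  \<open>U\<close> is a polynomial in \<open>p\<close>, and it must be constant if some locally nilpotent derivation does not
  kill \<open>p\<close>: take \<open>\<partial>/\<partial>p\<close> in the first case, and in the second the derivation with
  \<open>p \<mapsto> q\<close>, \<open>z \<mapsto> P'(p) / 2\<close> that kills \<open>q\<close> and \<open>y\<close>.
\<close>

section \<open>Polynomials in several variables\<close>

definition is_hom :: "('a::comm_ring_1 \<Rightarrow> 'c::comm_ring_1) \<Rightarrow> bool" where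
  "is_hom f \<longleftrightarrow> f 1 = 1 \<and> (\<forall>a b. f (a + b) = f a + f b) \<and> (\<forall>a b. f (a * b) = f a * f b)"

lemma is_hom_type_ring: "f \<in> ring_hom type_ring type_ring \<longleftrightarrow> is_hom f"
  by (auto simp: ring_hom_def is_hom_def ring_of_type_algebra_def)

lemma is_hom_simps:
  assumes "is_hom f"
  shows "f 1 = 1" "f 0 = 0" "f (a + b) = f a + f b" "f (a * b) = f a * f b"
    "f (- a) = - f a" "f (a - b) = f a - f b" "f (a ^ n) = f a ^ n" "f (of_nat n) = of_nat n"
    "f (of_int z) = of_int z" "f (numeral w) = numeral w" "f (sum g T) = (\<Sum>t\<in>T. f (g t))"
proof -
  show one: "f 1 = 1" using assms by (simp add: is_hom_def)
  show add: "f (a + b) = f a + f b" for a b using assms by (simp add: is_hom_def)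
  show mult: "f (a * b) = f a * f b" for a b using assms by (simp add: is_hom_def)
  show zero: "f 0 = 0" using add[of 0 0] by simp
  show neg: "f (- a) = - f a" for a using add[of a "- a"] zero by (simp add: add_eq_0_iff)
  show diff: "f (a - b) = f a - f b" for a b using add[of a "- b"] neg by simp
  show "f (a ^ n) = f a ^ n" by (induction n) (auto simp: one mult)
  show nat: "f (of_nat n) = of_nat n" for n by (induction n) (auto simp: one zero add)
  show "f (of_int z) = of_int z" by (cases z) (auto simp: nat neg diff one)
  show "f (numeral w) = numeral w" using nat[of "numeral w"] by simp
  show "f (sum g T) = (\<Sum>t\<in>T. f (g t))"
    by (induction T rule: infinite_finite_induct) (auto simp: zero add)
qed

lemma hom_field_eq_0_iff:
  fixes i :: "'k::field \<Rightarrow> 'b::idom"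
  assumes "is_hom i"
  shows "i c = 0 \<longleftrightarrow> c = 0"
proof
  assume "i c = 0"
  show "c = 0"
  proof (rule ccontr)
    assume "c \<noteq> 0"
    then have "i c * i (inverse c) = 1"
      by (simp flip: is_hom_simps(4)[OF assms] add: is_hom_simps[OF assms])
    with \<open>i c = 0\<close> show False by simp
  qed
qed (simp add: is_hom_simps[OF assms])

lemma Const_hom: "is_hom (Const :: 'k::field \<Rightarrow> ('n, 'k) mpol)"
  unfolding is_hom_def Const_def by (auto simp: single_add mult_single)

lemma mpol_sum_singles:
  "(\<Sum>m\<in>Poly_Mapping.keys p. Poly_Mapping.single m (Poly_Mapping.lookup p m)) = p"
  by (rule poly_mapping_eqI)
    (auto simp: lookup_sum lookup_single when_def sum.delta not_in_keys_iff_lookup_eq_zero)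

lemma Var_mult_single:
  "Var v * Poly_Mapping.single m (c::'k::field) = Poly_Mapping.single (Poly_Mapping.single v 1 + m) c"
  by (simp add: Var_def mult_single)

text \<open>
  A polynomial is built from constants by additions and multiplications with single variables, so
  identities about evaluation and partial derivatives need only be checked for these.
\<close>

lemma mpol_induct [case_names const add var]:
  fixes p :: "('n, 'k::field) mpol"
  assumes const: "\<And>c. Q (Const c)" and add: "\<And>p q. Q p \<Longrightarrow> Q q \<Longrightarrow> Q (p + q)"
    and var: "\<And>v p. Q p \<Longrightarrow> Q (Var v * p)"
  shows "Q p"
proof -
  have step: "Q (Poly_Mapping.single (Poly_Mapping.single v k + m) c)"
    if "Q (Poly_Mapping.single m c)" for v k m and c :: 'k
    using that
  proof (induction k)
    case (Suc k)
    then have "Q (Var v * Poly_Mapping.single (Poly_Mapping.single v k + m) c)" by (intro var) auto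
    moreover have "Poly_Mapping.single v (1::nat) + (Poly_Mapping.single v k + m)
        = Poly_Mapping.single v (Suc k) + m"
      by (simp add: single_add[symmetric] flip: add.assoc)
    ultimately show ?case by (simp only: Var_mult_single)
  qed auto
  have mono: "Q (Poly_Mapping.single m c)" for m :: "'n \<Rightarrow>\<^sub>0 nat" and c :: 'k
  proof (induction m rule: update_induct)
    case const
    then show ?case using assms(1) by (simp add: Const_def)
  next
    case (update m a b)
    have "Poly_Mapping.update a b m = Poly_Mapping.single a b + m"
      using update.hyps(1)
      by (intro poly_mapping_eqI)
        (auto simp: lookup_update lookup_add lookup_single when_def not_in_keys_iff_lookup_eq_zero)
    then show ?case using step update.IH by simp
  qed
  have "Q (\<Sum>m\<in>T. Poly_Mapping.single m (Poly_Mapping.lookup p m))" for T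
  proof (induction T rule: infinite_finite_induct)
    case (infinite T)
    then show ?case using const[of 0] by (simp add: Const_def)
  next
    case empty
    then show ?case using const[of 0] by (simp add: Const_def)
  next
    case (insert x F)
    then show ?case using add mono by simp
  qed
  from this[of "Poly_Mapping.keys p"] show ?thesis by (simp only: mpol_sum_singles)
qed

definition monomial_value :: "('n::finite \<Rightarrow> 'r) \<Rightarrow> ('n \<Rightarrow>\<^sub>0 nat) \<Rightarrow> 'r::comm_ring_1" where
  "monomial_value x m = (\<Prod>n\<in>UNIV. x n ^ Poly_Mapping.lookup m n)"

definition mpol_eval ::
  "('k::field \<Rightarrow> 'r) \<Rightarrow> ('n::finite \<Rightarrow> 'r) \<Rightarrow> ('n, 'k) mpol \<Rightarrow> 'r::comm_ring_1" where
  "mpol_eval j x p = (\<Sum>m\<in>Poly_Mapping.keys p. j (Poly_Mapping.lookup p m) * monomial_value x m)"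

lemma monomial_value_add: "monomial_value x (m + m') = monomial_value x m * monomial_value x m'"
  by (simp add: monomial_value_def lookup_add power_add prod.distrib)

lemma monomial_value_single: "monomial_value x (Poly_Mapping.single v k) = x v ^ k"
proof -
  have "monomial_value x (Poly_Mapping.single v k) = (\<Prod>n\<in>UNIV. if n = v then x v ^ k else 1)"
    unfolding monomial_value_def by (intro prod.cong) (auto simp: lookup_single when_def)
  then show ?thesis by simp
qed

lemma mpol_eval_single:
  assumes "is_hom j"
  shows "mpol_eval j x (Poly_Mapping.single m c) = j c * monomial_value x m"
  by (auto simp: mpol_eval_def is_hom_simps[OF assms])

lemma mpol_eval_add:
  assumes "is_hom j"
  shows "mpol_eval j x (p + q) = mpol_eval j x p + mpol_eval j x q"
  unfolding mpol_eval_def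
  by (rule setsum_keys_plus_distrib) (auto simp: is_hom_simps[OF assms] algebra_simps)

lemma mpol_eval_sum:
  assumes "is_hom j"
  shows "mpol_eval j x (\<Sum>t\<in>T. f t) = (\<Sum>t\<in>T. mpol_eval j x (f t))"
  by (induction T rule: infinite_finite_induct)
    (simp_all add: mpol_eval_add[OF assms] mpol_eval_def[of j x 0])

lemma mpol_eval_Const:
  assumes "is_hom j"
  shows "mpol_eval j x (Const c) = j c"
  unfolding Const_def mpol_eval_single[OF assms] by (simp add: monomial_value_def)

lemma mpol_eval_Var_mult:
  assumes "is_hom j"
  shows "mpol_eval j x (Var v * p) = x v * mpol_eval j x p"
proof -
  have "mpol_eval j x (Var v * Poly_Mapping.single m c)
      = x v * mpol_eval j x (Poly_Mapping.single m c)" for m c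
    unfolding Var_mult_single mpol_eval_single[OF assms] monomial_value_add monomial_value_single by simp
  then have "mpol_eval j x (Var v * (\<Sum>m\<in>T. Poly_Mapping.single m (f m)))
      = x v * mpol_eval j x (\<Sum>m\<in>T. Poly_Mapping.single m (f m))" for f T
    unfolding sum_distrib_left mpol_eval_sum[OF assms] by simp
  from this[of "Poly_Mapping.lookup p" "Poly_Mapping.keys p"] show ?thesis
    by (simp only: mpol_sum_singles)
qed

lemma mpol_eval_hom:
  assumes "is_hom j"
  shows "is_hom (mpol_eval j x)"
proof -
  have mult: "mpol_eval j x (p * q) = mpol_eval j x p * mpol_eval j x q" for p q
  proof (induction p rule: mpol_induct)
    case (const c)
    show ?case
    proof (induction q rule: mpol_induct)
      case (const d)
      have "Const c * Const d = Const (c * d)" by (simp add: is_hom_simps[OF Const_hom])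
      then show ?case by (metis assms is_hom_simps(4) mpol_eval_Const)
    next
      case (add p q)
      then show ?case by (simp add: distrib_left mpol_eval_add[OF assms])
    next
      case (var v p)
      have "mpol_eval j x (Const c * (Var v * p)) = mpol_eval j x (Var v * (Const c * p))"
        by (simp add: mult.left_commute)
      then show ?case using var by (simp only: mpol_eval_Var_mult[OF assms]) (simp add: mult.left_commute)
    qed
  next
    case (add p q)
    then show ?case by (simp add: distrib_right mpol_eval_add[OF assms])
  next
    case (var v p)
    then show ?case by (simp add: mult.assoc mpol_eval_Var_mult[OF assms])
  qed
  moreover have "mpol_eval j x 1 = 1"
    using mpol_eval_Const[OF assms, where c = 1 and x = x]
    by (simp add: is_hom_simps(1)[OF Const_hom] is_hom_simps(1)[OF assms])
  ultimately show ?thesis using mult by (simp add: is_hom_def mpol_eval_add[OF assms])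
qed

lemma mpol_eval_Var:
  assumes "is_hom j"
  shows "mpol_eval j x (Var v) = x v"
  using mpol_eval_Var_mult[OF assms, where x = x and v = v and p = 1]
    is_hom_simps(1)[OF mpol_eval_hom[OF assms, of x]] by simp

lemma partial_single:
  "partial v (Poly_Mapping.single m c)
    = Poly_Mapping.single (m - Poly_Mapping.single v 1) (of_nat (Poly_Mapping.lookup m v) * c)"
  by (auto simp: partial_def)

lemma partial_add: "partial v (p + q) = partial v p + partial v q"
  unfolding partial_def by (rule setsum_keys_plus_distrib) (auto simp: distrib_left single_add)

lemma partial_sum: "partial v (\<Sum>t\<in>T. f t) = (\<Sum>t\<in>T. partial v (f t))"
  by (induction T rule: infinite_finite_induct) (simp_all add: partial_add partial_def[of v 0])

lemma partial_Const: "partial v (Const c) = 0"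
  unfolding Const_def partial_single by simp

lemma partial_Var_mult:
  fixes p :: "('n, 'k::field) mpol"
  shows "partial v (Var w * p) = (if v = w then p else 0) + Var w * partial v p"
proof -
  have single: "partial v (Var w * Poly_Mapping.single m c)
      = (if v = w then Poly_Mapping.single m c else 0) + Var w * partial v (Poly_Mapping.single m c)"
    for m :: "'n \<Rightarrow>\<^sub>0 nat" and c :: 'k
  proof (cases "v = w")
    case True
    show ?thesis
    proof (cases "Poly_Mapping.lookup m v")
      case 0
      then show ?thesis using True unfolding Var_mult_single partial_single by (simp add: lookup_add)
    next
      case (Suc k)
      then have "Poly_Mapping.single v 1 + (m - Poly_Mapping.single v 1) = m"
        by (intro poly_mapping_eqI) (auto simp: lookup_add lookup_minus lookup_single when_def)
      then show ?thesis
        using True unfolding Var_mult_single partial_single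
        by (simp add: lookup_add distrib_right single_add)
    qed
  next
    case False
    show ?thesis
    proof (cases "Poly_Mapping.lookup m v")
      case 0
      then show ?thesis
        using False unfolding Var_mult_single partial_single by (simp add: lookup_add lookup_single)
    next
      case (Suc k)
      then have "Poly_Mapping.single w 1 + m - Poly_Mapping.single v 1
          = Poly_Mapping.single w 1 + (m - Poly_Mapping.single v 1)"
        using False by (intro poly_mapping_eqI) (auto simp: lookup_add lookup_minus lookup_single when_def)
      then show ?thesis
        using False unfolding Var_mult_single partial_single by (simp add: lookup_add lookup_single)
    qed
  qed
  have "partial v (Var w * (\<Sum>m\<in>T. Poly_Mapping.single m (f m)))
      = (if v = w then \<Sum>m\<in>T. Poly_Mapping.single m (f m) else 0)
        + Var w * partial v (\<Sum>m\<in>T. Poly_Mapping.single m (f m))" for f :: "_ \<Rightarrow> 'k" and T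
    unfolding sum_distrib_left partial_sum by (simp add: single sum.distrib)
  from this[of "Poly_Mapping.lookup p" "Poly_Mapping.keys p"] show ?thesis
    by (simp only: mpol_sum_singles)
qed

lemma partial_Var: "partial v (Var w) = (if v = w then 1 else (0 :: ('n, 'k::field) mpol))"
proof -
  have "partial v 1 = (0 :: ('n, 'k) mpol)"
    using partial_Const[of v 1] by (simp add: is_hom_simps[OF Const_hom])
  then show ?thesis using partial_Var_mult[of v w "1 :: ('n, 'k) mpol"] by simp
qed

lemma partial_derivation: "derivation (partial v :: ('n, 'k::field) mpol \<Rightarrow> _)"
proof -
  have "partial v (p * q) = p * partial v q + partial v p * q" for p q :: "('n, 'k) mpol"
  proof (induction p rule: mpol_induct)
    case (const c)
    show ?case
    proof (induction q rule: mpol_induct)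
      case (const d)
      have "Const c * Const d = (Const (c * d) :: ('n,'k) mpol)" by (simp add: is_hom_simps[OF Const_hom])
      then show ?case by (simp add: partial_Const)
    next
      case (add p q)
      then show ?case by (simp add: distrib_left partial_add partial_Const)
    next
      case (var w p)
      have "partial v (Const c * (Var w * p)) = partial v (Var w * (Const c * p))"
        by (simp add: mult.left_commute)
      then show ?case using var by (simp only: partial_Var_mult partial_Const) (simp add: algebra_simps)
    qed
  next
    case (add p q)
    then show ?case by (simp add: partial_add algebra_simps)
  next
    case (var w p)
    then show ?case by (simp only: partial_Var_mult mult.assoc) (simp add: algebra_simps)
  qed
  then show ?thesis by (simp add: derivation_def partial_add)
qed

text \<open>
  The chain rule.  It reduces the comparison of a derivation with a vector field on a polynomial
  ring to a comparison on the variables.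
\<close>

lemma derivation_mpol_eval:
  fixes D :: "'r::comm_ring_1 \<Rightarrow> 'r" and x :: "'n::finite \<Rightarrow> 'r"
  assumes "derivation D" "is_hom j" "\<And>c. D (j c) = 0"
  shows "D (mpol_eval j x p) = (\<Sum>v\<in>UNIV. D (x v) * mpol_eval j x (partial v p))"
proof (induction p rule: mpol_induct)
  case (const c)
  then show ?case
    by (simp add: mpol_eval_Const assms partial_Const is_hom_simps[OF mpol_eval_hom[OF assms(2)]])
next
  case (add p q)
  then show ?case
    using assms(1) by (simp add: mpol_eval_add assms(2) partial_add derivation_def distrib_left sum.distrib)
next
  case (var w p)
  have "(\<Sum>v\<in>UNIV. D (x v) * mpol_eval j x (partial v (Var w * p)))
      = (\<Sum>v\<in>UNIV. (if v = w then D (x w) * mpol_eval j x p else 0)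
          + x w * (D (x v) * mpol_eval j x (partial v p)))"
    by (intro sum.cong)
      (simp_all add: partial_Var_mult mpol_eval_add mpol_eval_Var_mult assms(2) distrib_left
        mult.left_commute mpol_eval_def[of j x 0])
  also have "\<dots> = D (x w) * mpol_eval j x p + x w * D (mpol_eval j x p)"
    by (simp add: sum.distrib var sum_distrib_left)
  also have "\<dots> = D (mpol_eval j x (Var w * p))"
    using assms(1) by (simp add: mpol_eval_Var_mult[OF assms(2)] derivation_def add.commute)
  finally show ?case by simp
qed

lemma UNIV_2: "(UNIV :: 2 set) = {0, 1}"
proof -
  have "x = 0 \<or> x = 1" for x :: 2
  proof (induction x)
    case (of_int z)
    then have "z = 0 \<or> z = 1" by fastforce
    then show ?case by auto
  qed
  then show ?thesis by auto
qed

lemma UNIV_3: "(UNIV :: 3 set) = {0, 1, 2}"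
proof -
  have "x = 0 \<or> x = 1 \<or> x = 2" for x :: 3
  proof (induction x)
    case (of_int z)
    then have "z = 0 \<or> z = 1 \<or> z = 2" by fastforce
    then show ?case by auto
  qed
  then show ?thesis by auto
qed

lemma UNIV_4: "(UNIV :: 4 set) = {0, 1, 2, 3}"
proof -
  have "x = 0 \<or> x = 1 \<or> x = 2 \<or> x = 3" for x :: 4
  proof (induction x)
    case (of_int z)
    then have "z = 0 \<or> z = 1 \<or> z = 2 \<or> z = 3" by fastforce
    then show ?case by auto
  qed
  then show ?thesis by auto
qed

lemma distinct_3: "(0::3) \<noteq> 1" "(0::3) \<noteq> 2" "(1::3) \<noteq> 2"
  by simp_all

lemma distinct_4: "(0::4) \<noteq> 1" "(0::4) \<noteq> 2" "(0::4) \<noteq> 3" "(1::4) \<noteq> 2" "(1::4) \<noteq> 3" "(2::4) \<noteq> 3"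
  by simp_all

lemma sum_3: "(\<Sum>v\<in>(UNIV :: 3 set). f v) = f 0 + f 1 + f 2"
  unfolding UNIV_3 using distinct_3 by (simp add: add.assoc)

lemma prod_3: "(\<Prod>v\<in>(UNIV :: 3 set). f v) = f 0 * f 1 * f 2"
  unfolding UNIV_3 using distinct_3 by (simp add: mult.assoc)

lemma sum_4: "(\<Sum>v\<in>(UNIV :: 4 set). f v) = f 0 + f 1 + f 2 + f 3"
  unfolding UNIV_4 using distinct_4 by (simp add: add.assoc)

lemma prod_4: "(\<Prod>v\<in>(UNIV :: 4 set). f v) = f 0 * f 1 * f 2 * f 3"
  unfolding UNIV_4 using distinct_4 by (simp add: mult.assoc)

section \<open>Locally nilpotent derivations in characteristic zero\<close>

lemma derivation_simps:
  assumes "derivation D"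
  shows "D (a + b) = D a + D b" "D (a * b) = a * D b + D a * b" "D 0 = 0" "D 1 = 0" "D (- a) = - D a"
    "D (a - b) = D a - D b" "D (of_nat n) = 0" "D (of_int z) = 0" "D (numeral w) = 0"
    "D (sum f T) = (\<Sum>t\<in>T. D (f t))"
    "(D ^^ n) 0 = 0" "(D ^^ n) (a + b) = (D ^^ n) a + (D ^^ n) b"
    "(D ^^ n) (a - b) = (D ^^ n) a - (D ^^ n) b"
    "(D ^^ n) (sum f T) = (\<Sum>t\<in>T. (D ^^ n) (f t))"
proof -
  show add: "D (a + b) = D a + D b" for a b using assms by (simp add: derivation_def)
  show mult: "D (a * b) = a * D b + D a * b" for a b using assms by (simp add: derivation_def)
  show zero: "D 0 = 0" using add[of 0 0] by simp
  show one: "D 1 = 0" using mult[of 1 1] by simp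
  show neg: "D (- a) = - D a" for a using add[of a "- a"] zero by (simp add: add_eq_0_iff)
  show diff: "D (a - b) = D a - D b" for a b using add[of a "- b"] neg by simp
  show nat: "D (of_nat n) = 0" for n by (induction n) (auto simp: one zero add)
  show "D (of_int z) = 0" by (cases z) (auto simp: nat neg diff one)
  show "D (numeral w) = 0" using nat[of "numeral w"] by simp
  show "D (sum f T) = (\<Sum>t\<in>T. D (f t))"
    by (induction T rule: infinite_finite_induct) (auto simp: zero add)
  show fzero: "(D ^^ n) 0 = 0" by (induction n) (auto simp: zero)
  show fadd: "(D ^^ n) (a + b) = (D ^^ n) a + (D ^^ n) b" for a b by (induction n) (auto simp: add)
  show "(D ^^ n) (a - b) = (D ^^ n) a - (D ^^ n) b" by (induction n) (auto simp: diff)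
  show "(D ^^ n) (sum f T) = (\<Sum>t\<in>T. (D ^^ n) (f t))"
    by (induction T rule: infinite_finite_induct) (auto simp: fzero fadd)
qed

lemma derivation_mult_const:
  assumes "derivation D" "D c = 0"
  shows "D (c * b) = c * D b" "(D ^^ n) (c * b) = c * (D ^^ n) b"
proof -
  show *: "D (c * b) = c * D b" for b using assms by (simp add: derivation_simps)
  show "(D ^^ n) (c * b) = c * (D ^^ n) b" by (induction n) (auto simp: *)
qed

text \<open>
  Only one term of the Leibniz formula for \<open>D\<^sup>m\<^sup>+\<^sup>n (a b)\<close> survives when \<open>D\<^sup>m a\<close> and \<open>D\<^sup>n b\<close> are
  the last nonzero iterates.  Hence the nilpotency degree of \<open>D\<close> behaves like the degree of
  polynomials: in a domain of characteristic zero it is additive.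
\<close>

lemma leibniz_top:
  assumes D: "derivation D" and "(D ^^ Suc m) a = 0" "(D ^^ Suc n) b = 0"
  shows "(D ^^ (m + n)) (a * b) = of_nat ((m + n) choose m) * (D ^^ m) a * (D ^^ n) b
    \<and> (D ^^ Suc (m + n)) (a * b) = 0"
  using assms(2,3)
proof (induction "m + n" arbitrary: m n a b rule: less_induct)
  case less
  note ds = derivation_simps[OF D] derivation_mult_const[OF D]
  consider "m = 0" "n = 0" | n' where "m = 0" "n = Suc n'" | m' where "m = Suc m'" "n = 0"
    | m' n' where "m = Suc m'" "n = Suc n'"
    by (meson not0_implies_Suc)
  then show ?case
  proof cases
    case 1
    then show ?thesis using less.prems by (simp add: ds)
  next
    case 2
    then have "D a = 0" using less.prems by simp
    then show ?thesis using 2 less.prems by (simp add: ds del: funpow.simps)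
  next
    case 3
    then have "D b = 0" using less.prems by simp
    then show ?thesis using 3 less.prems by (simp add: ds mult.commute[of _ b] del: funpow.simps)
  next
    case 4
    have lt: "m + n' < m + n" "m' + n < m + n" using 4 by auto
    have b: "(D ^^ Suc n') (D b) = 0" "(D ^^ n') (D b) = (D ^^ n) b"
      using less.prems(2) 4 by (simp_all add: funpow_swap1)
    have a: "(D ^^ Suc m') (D a) = 0" "(D ^^ m') (D a) = (D ^^ m) a"
      using less.prems(1) 4 by (simp_all add: funpow_swap1)
    note 1 = less.hyps[OF lt(1) less.prems(1) b(1), unfolded b(2)]
    note 2 = less.hyps[OF lt(2) a(1) less.prems(2), unfolded a(2)]
    have "m + n = Suc (m + n')" and mn: "m' + n = m + n'" using 4 by auto
    then have split: "(D ^^ (m + n)) (a * b) = (D ^^ (m + n')) (a * D b) + (D ^^ (m' + n)) (D a * b)"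
      by (simp only: funpow_Suc_right o_apply ds mn)
    then have "(D ^^ Suc (m + n)) (a * b) = (D ^^ Suc (m + n')) (a * D b) + (D ^^ Suc (m' + n)) (D a * b)"
      by (simp add: ds)
    moreover have "((m + n) choose m) = ((m + n') choose m) + ((m' + n) choose m')"
      using 4 by simp
    ultimately show ?thesis using split 1 2 by (simp only: of_nat_add distrib_right) simp
  qed
qed

text \<open>
  Elements of pairwise different nilpotency degree are linearly independent over the kernel: if \<open>M\<close> is
  the largest degree that occurs, then \<open>D\<^sup>M\<close> isolates the coefficient at \<open>M\<close>.
\<close>

lemma independent_over_kernel:
  fixes D :: "'b::idom \<Rightarrow> 'b"
  assumes D: "derivation D" and "finite J"
    and "\<And>j. j \<in> J \<Longrightarrow> D (a j) = 0"
    and "\<And>j. j \<in> J \<Longrightarrow> (D ^^ Suc j) (b j) = 0" "\<And>j. j \<in> J \<Longrightarrow> (D ^^ j) (b j) \<noteq> 0"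
    and "(\<Sum>j\<in>J. a j * b j) = 0" "j \<in> J"
  shows "a j = 0"
proof -
  have high: "(D ^^ n) x = 0" if "(D ^^ Suc m) x = 0" "m < n" for x m n
  proof -
    have "(D ^^ (n - Suc m + Suc m)) x = 0"
      unfolding funpow_add by (simp only: that o_apply derivation_simps[OF D])
    then show ?thesis using that by simp
  qed
  have "\<forall>j\<in>J. a j = 0" using assms(2-6)
  proof (induction J rule: finite_linorder_max_induct)
    case (insert M J)
    have "0 = (D ^^ M) (\<Sum>j\<in>insert M J. a j * b j)"
      using insert.prems(4) derivation_simps[OF D] by simp
    also have "\<dots> = (\<Sum>j\<in>insert M J. a j * (D ^^ M) (b j))"
      unfolding derivation_simps[OF D] using insert.prems(1) derivation_mult_const(2)[OF D]
      by (intro sum.cong) auto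
    also have "\<dots> = (\<Sum>j\<in>insert M J. if j = M then a M * (D ^^ M) (b M) else 0)"
      using insert.hyps(2) insert.prems(2) by (intro sum.cong refl) (auto intro: high simp del: funpow.simps)
    also have "\<dots> = a M * (D ^^ M) (b M)" using insert.hyps(1) by simp
    finally have "a M = 0" using insert.prems(3) by auto
    moreover have "M \<notin> J" using insert.hyps(2) by auto
    ultimately show ?case using insert by auto
  qed auto
  then show ?thesis using assms(7) by blast
qed

lemma LND_top:
  assumes "D \<in> LND" "b \<noteq> 0"
  obtains m where "(D ^^ m) b \<noteq> 0" "(D ^^ Suc m) b = 0"
proof -
  obtain n where n: "(D ^^ n) b = 0" using assms(1) by (auto simp: LND_def)
  define N where "N = (LEAST n. (D ^^ n) b = 0)"
  have N: "(D ^^ N) b = 0" unfolding N_def using n by (rule LeastI)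
  then obtain m where m: "N = Suc m" using assms(2) by (cases N) auto
  have "(D ^^ m) b \<noteq> 0"
    using not_less_Least[of m "\<lambda>n. (D ^^ n) b = 0"] m unfolding N_def by auto
  then show ?thesis using that N m by simp
qed

lemma locally_nilpotent_mult:
  assumes "derivation D" "(D ^^ m) a = 0" "(D ^^ n) b = 0"
  shows "\<exists>N. (D ^^ N) (a * b) = 0"
  using leibniz_top[OF assms(1), of m a n b] assms by (auto simp: derivation_simps[OF assms(1)])

text \<open>
  The type class of \<open>'b\<close> says nothing about its characteristic; it is zero because \<open>'k\<close> embeds.
\<close>

locale char0_algebra =
  fixes i :: "'k::field_char_0 \<Rightarrow> 'b::idom"
  assumes i_hom: "is_hom i"
begin

lemmas i_simps = is_hom_simps[OF i_hom]

lemma i_eq_0_iff: "i c = 0 \<longleftrightarrow> c = 0"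
  by (rule hom_field_eq_0_iff[OF i_hom])

lemma of_int_eq_0_iff': "(of_int z :: 'b) = 0 \<longleftrightarrow> z = 0"
  using i_eq_0_iff[of "of_int z"] by (simp add: i_simps)

lemma of_nat_eq_0_iff': "(of_nat n :: 'b) = 0 \<longleftrightarrow> n = 0"
  using i_eq_0_iff[of "of_nat n"] by (simp add: i_simps)

text \<open>
  Nilpotency degrees add up in products, so a factor of an element of degree 0 has degree 0.
\<close>

lemma LND_factor:
  fixes D :: "'b \<Rightarrow> 'b"
  assumes D: "D \<in> LND" and "a * b \<noteq> 0" "D (a * b) = 0"
  shows "D a = 0"
proof -
  have der: "derivation D" using D by (auto simp: LND_def)
  have "a \<noteq> 0" "b \<noteq> 0" using assms(2) by auto
  then obtain m n where m: "(D ^^ m) a \<noteq> 0" "(D ^^ Suc m) a = 0"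
    and n: "(D ^^ n) b \<noteq> 0" "(D ^^ Suc n) b = 0"
    using LND_top[OF D] by metis
  have "(of_nat ((m + n) choose m) :: 'b) \<noteq> 0" by (simp add: of_nat_eq_0_iff')
  then have "(D ^^ (m + n)) (a * b) \<noteq> 0"
    unfolding conjunct1[OF leibniz_top[OF der m(2) n(2)]] using m(1) n(1) by simp
  moreover have "(D ^^ Suc l) (a * b) = 0" for l
    unfolding funpow_Suc_right o_apply assms(3) by (rule derivation_simps(11)[OF der])
  ultimately have "m + n = 0" by (metis not0_implies_Suc)
  then show ?thesis using m(2) by simp
qed

text \<open>
  Constants are units or 0, and a unit divides \<open>1\<close>, which lies in the kernel.
\<close>

lemma LND_i:
  assumes D: "D \<in> LND"
  shows "D (i c) = 0"
proof (cases "c = 0")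
  case True
  then show ?thesis using D by (simp add: i_simps LND_def derivation_simps)
next
  case False
  have "i c * i (inverse c) = 1" using False by (simp flip: i_simps)
  then show ?thesis
    using LND_factor[OF D, of "i c" "i (inverse c)"] D by (simp add: LND_def derivation_simps)
qed

end

section \<open>Weights of a fundamental pair\<close>

locale sl2_pair = char0_algebra i for i :: "'k::field_char_0 \<Rightarrow> 'b::idom" +
  fixes D U :: "'b \<Rightarrow> 'b"
  assumes pair: "fundamental_pair D U"
begin

abbreviation H :: "'b \<Rightarrow> 'b" where "H \<equiv> commutator D U"

definition wt :: "int \<Rightarrow> 'b \<Rightarrow> bool" where "wt e b \<longleftrightarrow> H b = of_int e * b"

lemma D_LND: "D \<in> LND" and U_LND: "U \<in> LND"
  using pair by (auto simp: fundamental_pair_def)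

lemma D_der: "derivation D" and U_der: "derivation U"
  using D_LND U_LND by (auto simp: LND_def)

lemmas D_simps = derivation_simps[OF D_der]
lemmas U_simps = derivation_simps[OF U_der]

lemma H_der: "derivation H"
  unfolding derivation_def commutator_def by (simp add: D_simps U_simps algebra_simps)

lemmas H_simps = derivation_simps[OF H_der]

lemma D_i [simp]: "D (i c) = 0" and U_i [simp]: "U (i c) = 0"
  using LND_i D_LND U_LND by auto

lemma H_i [simp]: "H (i c) = 0"
  by (simp add: commutator_def D_simps U_simps)

lemma DU: "D (U b) = U (D b) + H b"
  by (simp add: commutator_def)

lemma HD: "H (D b) = D (H b) + 2 * D b"
proof -
  have "commutator D H b = - 2 * D b" using pair by (simp add: fundamental_pair_def)
  then show ?thesis by (simp add: commutator_def[of D H] algebra_simps)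
qed

lemma HU: "H (U b) = U (H b) - 2 * U b"
proof -
  have "commutator U H b = 2 * U b" using pair by (simp add: fundamental_pair_def)
  then show ?thesis by (simp add: commutator_def[of U H] algebra_simps)
qed

lemma wt_weight_space: "b \<in> weight_space D U e \<longleftrightarrow> wt e b"
  by (simp add: weight_space_def Ker_def wt_def)

lemma wt_0 [simp]: "wt e 0"
  by (simp add: wt_def H_simps)

lemma wt_i [simp]: "wt 0 (i c)"
  by (simp add: wt_def)

lemma wt_add: "wt e a \<Longrightarrow> wt e b \<Longrightarrow> wt e (a + b)"
  by (simp add: wt_def H_simps distrib_left)

lemma wt_diff: "wt e a \<Longrightarrow> wt e b \<Longrightarrow> wt e (a - b)"
  by (simp add: wt_def H_simps right_diff_distrib)

lemma wt_sum: "(\<And>t. t \<in> T \<Longrightarrow> wt e (f t)) \<Longrightarrow> wt e (\<Sum>t\<in>T. f t)"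
  by (induction T rule: infinite_finite_induct) (auto intro: wt_add)

lemma wt_mult: "wt e a \<Longrightarrow> wt f b \<Longrightarrow> wt (e + f) (a * b)"
  by (simp add: wt_def H_simps algebra_simps)

lemma wt_power: "wt e a \<Longrightarrow> wt (int n * e) (a ^ n)"
proof (induction n)
  case 0
  then show ?case by (simp add: wt_def H_simps)
next
  case (Suc n)
  then show ?case using wt_mult[of e a "int n * e" "a ^ n"] by (simp add: algebra_simps)
qed

lemma wt_of_int_mult: "wt e b \<Longrightarrow> wt e (of_int z * b)"
  by (simp add: wt_def H_simps algebra_simps)

lemma wt_i_mult: "wt e b \<Longrightarrow> wt e (i c * b)"
  using wt_mult[of 0 "i c" e b] by simp

lemma wt_D: "wt e b \<Longrightarrow> wt (e + 2) (D b)"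
  by (simp add: wt_def HD D_simps algebra_simps)

lemma wt_U: "wt e b \<Longrightarrow> wt (e - 2) (U b)"
  by (simp add: wt_def HU U_simps algebra_simps)

lemma wt_D_pow: "wt e b \<Longrightarrow> wt (e + 2 * int m) ((D ^^ m) b)"
proof (induction m)
  case (Suc m)
  then show ?case using wt_D[of "e + 2 * int m" "(D ^^ m) b"] by (simp add: algebra_simps)
qed simp

lemma wt_U_pow: "wt e b \<Longrightarrow> wt (e - 2 * int m) ((U ^^ m) b)"
proof (induction m)
  case (Suc m)
  then show ?case using wt_U[of "e - 2 * int m" "(U ^^ m) b"] by (simp add: algebra_simps)
qed simp

text \<open>
  Subtracting the weight of one summand from \<open>H\<close> kills that summand and multiplies each of the others
  by a nonzero integer.
\<close>

lemma wt_unique_weights: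
  assumes "finite T" "inj_on g T" "\<And>t. t \<in> T \<Longrightarrow> wt (g t) (f t)" "(\<Sum>t\<in>T. f t) = 0"
  shows "\<forall>t\<in>T. f t = 0"
  using assms
proof (induction T arbitrary: f)
  case (insert s T)
  have s: "f s = - (\<Sum>t\<in>T. f t)" using insert.prems(3) insert.hyps by (simp add: add_eq_0_iff)
  have "(\<Sum>t\<in>T. of_int (g t - g s) * f t) = (\<Sum>t\<in>T. H (f t) - of_int (g s) * f t)"
    using insert.prems(2) by (intro sum.cong) (auto simp: wt_def algebra_simps)
  also have "\<dots> = H (\<Sum>t\<in>T. f t) - of_int (g s) * (\<Sum>t\<in>T. f t)"
    by (simp add: H_simps sum_subtractf sum_distrib_left)
  also have "\<dots> = - H (f s) + of_int (g s) * f s"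
    unfolding s by (simp add: H_simps)
  also have "\<dots> = 0" using insert.prems(2)[of s] by (simp add: wt_def)
  finally have "(\<Sum>t\<in>T. of_int (g t - g s) * f t) = 0" .
  then have "\<forall>t\<in>T. of_int (g t - g s) * f t = 0"
    using insert.prems(1,2) by (intro insert.IH wt_of_int_mult) auto
  moreover have "g t \<noteq> g s" if "t \<in> T" for t
    using that insert.prems(1) insert.hyps by (auto simp: inj_on_def)
  ultimately have "\<forall>t\<in>T. f t = 0"
    using of_int_eq_0_iff' by (metis mult_eq_0_iff right_minus_eq)
  then show ?case using s by simp
qed simp

text \<open>
  The \<open>sl\<^sub>2\<close> commutation formula; the coefficient is the sum of the weights of \<open>b, U b, \<dots>, U\<^sup>j b\<close>.
\<close>

lemma D_U_pow:
  assumes "wt e b"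
  shows "D ((U ^^ Suc j) b) = (U ^^ Suc j) (D b) + of_int ((int j + 1) * (e - int j)) * (U ^^ j) b"
proof (induction j)
  case 0
  then show ?case using assms by (simp add: DU wt_def)
next
  case (Suc j)
  have "D ((U ^^ Suc (Suc j)) b) = U (D ((U ^^ Suc j) b)) + H ((U ^^ Suc j) b)"
    by (simp add: DU)
  also have "H ((U ^^ Suc j) b) = of_int (e - 2 * int (Suc j)) * (U ^^ Suc j) b"
    using wt_U_pow[OF assms, of "Suc j"] by (simp add: wt_def)
  also have "U (D ((U ^^ Suc j) b)) = (U ^^ Suc (Suc j)) (D b)
      + of_int ((int j + 1) * (e - int j)) * (U ^^ Suc j) b"
    unfolding Suc
    by (simp only: U_simps(1) derivation_mult_const(1)[OF U_der U_simps(8)] funpow.simps o_apply)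
  finally have "D ((U ^^ Suc (Suc j)) b) = (U ^^ Suc (Suc j)) (D b)
      + (of_int ((int j + 1) * (e - int j)) + of_int (e - 2 * int (Suc j))) * (U ^^ Suc j) b"
    by (simp only: distrib_right add.assoc)
  moreover have "(int j + 1) * (e - int j) + (e - 2 * int (Suc j)) = (int (Suc j) + 1) * (e - int (Suc j))"
    by (simp add: algebra_simps)
  ultimately show ?case by (simp only: of_int_add[symmetric])
qed

text \<open>
  If \<open>D b\<close> is killed by \<open>U\<close>, then \<open>D U\<^sup>j\<^sup>+\<^sup>1 b\<close> is a nonzero multiple of \<open>U\<^sup>j b\<close>: the coefficient
  \<open>(j + 1) (e - j)\<close> vanishes for no \<open>j\<close> when \<open>e < 0\<close>.  So no power of \<open>U\<close> could kill a nonzero \<open>b\<close>.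
\<close>

lemma negative_weight_eq_0:
  assumes "wt e b" "e < 0" "U (D b) = 0"
  shows "b = 0"
proof (rule ccontr)
  assume "b \<noteq> 0"
  then obtain m where m: "(U ^^ m) b \<noteq> 0" "(U ^^ Suc m) b = 0" by (rule LND_top[OF U_LND])
  have "(U ^^ Suc m) (D b) = 0"
    unfolding funpow_Suc_right o_apply assms(3) by (rule U_simps(11))
  then have "of_int ((int m + 1) * (e - int m)) * (U ^^ m) b = 0"
    using D_U_pow[OF assms(1), of m] unfolding m(2) by (simp add: D_simps)
  moreover have "(int m + 1) * (e - int m) \<noteq> 0" using assms(2) by auto
  ultimately show False using m(1) of_int_eq_0_iff' by (metis mult_eq_0_iff)
qed

lemma Ker_D_weight_nonneg: "wt e b \<Longrightarrow> D b = 0 \<Longrightarrow> e < 0 \<Longrightarrow> b = 0"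
  using negative_weight_eq_0 by (simp add: U_simps)

lemma D_pow_U_pow:
  assumes "wt (int n) a" "D a = 0" "m \<le> n"
  shows "\<exists>c::int. c \<noteq> 0 \<and> (D ^^ m) ((U ^^ m) a) = of_int c * a"
  using assms(3)
proof (induction m)
  case 0
  then show ?case by (intro exI[of _ 1]) simp
next
  case (Suc m)
  then obtain c :: int where c: "c \<noteq> 0" "(D ^^ m) ((U ^^ m) a) = of_int c * a" by auto
  have "(U ^^ Suc m) (D a) = 0" unfolding assms(2) by (rule U_simps(11))
  then have "D ((U ^^ Suc m) a) = of_int ((int m + 1) * (int n - int m)) * (U ^^ m) a"
    using D_U_pow[OF assms(1), of m] by simp
  then have "(D ^^ Suc m) ((U ^^ Suc m) a)
      = (D ^^ m) (of_int ((int m + 1) * (int n - int m)) * (U ^^ m) a)"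
    by (simp only: funpow_Suc_right o_apply)
  also have "\<dots> = of_int ((int m + 1) * (int n - int m)) * (of_int c * a)"
    by (simp only: derivation_mult_const(2)[OF D_der D_simps(8)] c(2))
  also have "\<dots> = of_int (((int m + 1) * (int n - int m)) * c) * a" by (simp only: of_int_mult mult.assoc)
  finally show ?case using c(1) Suc.prems
    by (intro exI[of _ "((int m + 1) * (int n - int m)) * c"]) auto
qed

lemma U_pow_eq_0:
  assumes "wt (int n) a" "D a = 0"
  shows "(U ^^ Suc n) a = 0"
proof (rule Ker_D_weight_nonneg)
  show "wt (int n - 2 * int (Suc n)) ((U ^^ Suc n) a)" by (rule wt_U_pow[OF assms(1)])
  have "(U ^^ Suc n) (D a) = 0" unfolding assms(2) by (rule U_simps(11))
  then show "D ((U ^^ Suc n) a) = 0" using D_U_pow[OF assms(1), of n] by simp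
qed auto

text \<open>
  The substitute for complete reducibility.  In a finite-dimensional representation \<open>D\<^sup>m\<close> is
  injective on the space of weight \<open>e \<le> -m\<close>.  The only case in which the induction cannot pass from \<open>b\<close>
  to \<open>D b\<close> is \<open>e = -m\<close>; then \<open>D b\<close> is compared with the image under a power of \<open>U\<close> of its highest
  weight vector.
\<close>

lemma D_pow_inj_negative_weight:
  assumes "wt e b" "e \<le> - int m" "(D ^^ m) b = 0"
  shows "b = 0"
  using assms
proof (induction m arbitrary: e b rule: less_induct)
  case (less m)
  consider "m = 0" | m' where "m = Suc m'" "e \<le> - int m' - 2" | "m = 1" "e = -1"
    | n where "m = Suc (Suc n)" "e = - int n - 2"
    using less.prems(2) by (cases m; cases "m - 1"; force)
  then show ?case
  proof cases
    case 1
    then show ?thesis using less.prems by simp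
  next
    case 2
    have "D b = 0"
      using less.IH[of m' "e + 2" "D b"] less.prems wt_D 2 by (simp add: funpow_swap1)
    then show ?thesis using Ker_D_weight_nonneg[OF less.prems(1)] 2 by simp
  next
    case 3
    then show ?thesis using Ker_D_weight_nonneg[OF less.prems(1)] less.prems(3) by simp
  next
    case 4
    define a where "a = (D ^^ n) (D b)"
    have Da: "D a = 0" using less.prems(3) 4 by (simp add: a_def funpow_swap1)
    have wD: "wt (- int n) (D b)" using wt_D[OF less.prems(1)] 4 by simp
    have wa: "wt (int n) a" using wt_D_pow[OF wD, of n] by (simp add: a_def)
    obtain c :: int where c: "c \<noteq> 0" "(D ^^ n) ((U ^^ n) a) = of_int c * a"
      using D_pow_U_pow[OF wa Da, of n] by auto
    \<comment> \<open>the difference has weight \<open>-n\<close> and is killed by \<open>D\<^sup>n\<close>\<close>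
    have "of_int c * D b - (U ^^ n) a = 0"
    proof (rule less.IH[of n "- int n"])
      show "wt (- int n) (of_int c * D b - (U ^^ n) a)"
        using wt_U_pow[OF wa, of n] wD by (intro wt_diff wt_of_int_mult) auto
      show "(D ^^ n) (of_int c * D b - (U ^^ n) a) = 0"
        by (simp only: D_simps(13) derivation_mult_const(2)[OF D_der D_simps(8)] c(2)
            a_def[symmetric] diff_self)
    qed (use 4 in auto)
    then have "U (of_int c * D b) = (U ^^ Suc n) a" by simp
    then have "of_int c * U (D b) = 0"
      using U_pow_eq_0[OF wa Da] by (simp add: derivation_mult_const(1)[OF U_der U_simps(8)])
    then have "U (D b) = 0" using c(1) of_int_eq_0_iff' by (metis mult_eq_0_iff)
    then show ?thesis using negative_weight_eq_0[OF less.prems(1)] 4 by simp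
  qed
qed

text \<open>
  \<open>B\<close> is generated by \<open>ker D\<close> as a module over \<open>k[U]\<close>.  A homogeneous \<open>b\<close> with \<open>D\<^sup>m b = a \<in> ker D\<close> is
  corrected by a multiple of \<open>U\<^sup>m a\<close>, which lowers its nilpotency degree.  This works as long as
  \<open>m\<close> is at most the weight of \<open>a\<close>, and otherwise \<open>b = 0\<close>.
\<close>

lemma U_stable_span_of_kernel:
  assumes add: "\<And>a b. a \<in> S \<Longrightarrow> b \<in> S \<Longrightarrow> a + b \<in> S"
    and scale: "\<And>c a. a \<in> S \<Longrightarrow> i c * a \<in> S"
    and U: "\<And>a. a \<in> S \<Longrightarrow> U a \<in> S"
    and A: "\<And>a n. D a = 0 \<Longrightarrow> wt (int n) a \<Longrightarrow> a \<in> S"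
  shows "b \<in> S"
proof -
  have zero: "0 \<in> S" using A[of 0 0] by (simp add: D_simps)
  have Upow: "(U ^^ m) a \<in> S" if "a \<in> S" for m a using that by (induction m) (auto intro: U)
  have wt_in: "b \<in> S" if "wt e b" "(D ^^ m) b = 0" for e b m
    using that
  proof (induction m arbitrary: b)
    case 0
    then show ?case using zero by simp
  next
    case (Suc m)
    define a where "a = (D ^^ m) b"
    have Da: "D a = 0" using Suc.prems(2) by (simp add: a_def)
    have wa: "wt (e + 2 * int m) a" using wt_D_pow[OF Suc.prems(1)] by (simp add: a_def)
    consider "a = 0" | "e \<le> - int (Suc m)" | n where "e + 2 * int m = int n" "m \<le> n"
      using Ker_D_weight_nonneg[OF wa Da] by (cases "e + 2 * int m") force+
    then show ?case
    proof cases
      case 1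
      then show ?thesis using Suc by (simp add: a_def)
    next
      case 2
      then show ?thesis using D_pow_inj_negative_weight Suc.prems zero by blast
    next
      case 3
      then have wn: "wt (int n) a" using wa by simp
      obtain c :: int where c: "c \<noteq> 0" "(D ^^ m) ((U ^^ m) a) = of_int c * a"
        using D_pow_U_pow[OF wn Da 3(2)] by auto
      have "i (inverse (of_int c)) * i (of_int c) = 1" using c(1) by (simp flip: i_simps)
      then have inv: "i (inverse (of_int c)) * (of_int c * a) = a"
        by (simp add: i_simps flip: mult.assoc)
      \<comment> \<open>\<open>D\<^sup>m U\<^sup>m a = c a\<close>, so that \<open>D\<^sup>m\<close> kills \<open>b'\<close>\<close>
      define b' where "b' = b - i (inverse (of_int c)) * (U ^^ m) a"
      have "int n - 2 * int m = e" using 3(1) by simp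
      then have "wt e ((U ^^ m) a)" using wt_U_pow[OF wn, of m] by simp
      then have "wt e b'" unfolding b'_def using Suc.prems(1) by (intro wt_diff wt_i_mult)
      moreover have "(D ^^ m) b' = 0"
        by (simp only: b'_def D_simps(13) derivation_mult_const(2)[OF D_der D_i] c(2) inv)
          (simp add: a_def)
      ultimately have "b' \<in> S" by (rule Suc.IH)
      then have "b' + i (inverse (of_int c)) * (U ^^ m) a \<in> S"
        using A[OF Da wn] by (intro add scale Upow)
      then show ?thesis by (simp add: b'_def)
    qed
  qed
  obtain T f where T: "finite T" "\<forall>d\<in>T. f d \<in> weight_space D U d" "b = (\<Sum>d\<in>T. f d)"
    using pair unfolding fundamental_pair_def by blast
  have "f d \<in> S" if "d \<in> T" for d
  proof -
    obtain m where "(D ^^ m) (f d) = 0" using D_LND by (auto simp: LND_def)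
    then show ?thesis using wt_in T(2) that wt_weight_space by blast
  qed
  with T(1) have "(\<Sum>d\<in>T. f d) \<in> S"
    by (induction T rule: finite_induct) (auto intro: zero add)
  then show ?thesis using T(3) by simp
qed

end

section \<open>The grading of the kernel\<close>

text \<open>
  The lowest and the highest term of a product are the products of those of the factors.
\<close>

lemma monom_factor:
  fixes p q :: "'a::idom poly"
  assumes "p * q = monom c n" "c \<noteq> 0"
  shows "\<exists>a k. p = monom a k"
proof -
  have "p \<noteq> 0" "q \<noteq> 0" using assms by auto
  define k where "k = (LEAST k. coeff p k \<noteq> 0)"
  define l where "l = (LEAST l. coeff q l \<noteq> 0)"
  have k: "coeff p k \<noteq> 0"
    unfolding k_def by (rule LeastI[of _ "degree p"]) (use \<open>p \<noteq> 0\<close> in simp)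
  have k': "coeff p m = 0" if "m < k" for m
    using not_less_Least that unfolding k_def by blast
  have l: "coeff q l \<noteq> 0"
    unfolding l_def by (rule LeastI[of _ "degree q"]) (use \<open>q \<noteq> 0\<close> in simp)
  have l': "coeff q m = 0" if "m < l" for m
    using not_less_Least that unfolding l_def by blast
  have "coeff (p * q) (k + l) = (\<Sum>m\<le>k + l. if m = k then coeff p k * coeff q l else 0)"
    unfolding coeff_mult
  proof (intro sum.cong refl)
    fix m assume "m \<in> {..k + l}"
    then show "coeff p m * coeff q (k + l - m) = (if m = k then coeff p k * coeff q l else 0)"
      using k'[of m] l'[of "k + l - m"] by (cases m k rule: linorder_cases) auto
  qed
  then have "coeff (monom c n) (k + l) \<noteq> 0" using k l assms(1) by simp
  then have "n = k + l" by (auto split: if_splits)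
  moreover have "degree p + degree q = n"
    using degree_mult_eq[OF \<open>p \<noteq> 0\<close> \<open>q \<noteq> 0\<close>] assms by (simp add: degree_monom_eq)
  moreover have "k \<le> degree p" "l \<le> degree q" using k l le_degree by auto
  ultimately have "degree p = k" by simp
  then have "p = monom (coeff p k) k"
    using k' le_degree[of p] by (intro poly_eqI) (metis coeff_monom le_neq_implies_less)
  then show ?thesis by blast
qed

context sl2_pair
begin

lemma Ker_D_mult_cancel:
  assumes "D (a * b) = 0" "D a = 0" "a \<noteq> 0"
  shows "D b = 0"
  using assms derivation_mult_const(1)[OF D_der, of a b] by simp

lemma wt_mult_cancel:
  assumes "wt e (a * b)" "wt f a" "a \<noteq> 0"
  shows "wt (e - f) b"
proof -
  have "a * H b + H a * b = of_int e * (a * b)" using assms(1) by (simp add: wt_def H_simps)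
  then have "a * (H b - of_int (e - f) * b) = 0" using assms(2) by (simp add: wt_def algebra_simps)
  then show ?thesis using assms(3) by (simp add: wt_def)
qed

text \<open>
  An element of \<open>ker D\<close> is represented by the polynomial whose coefficient at \<open>n\<close> is its component of
  weight \<open>n\<close>; the element itself is the value at 1.  Thus the grading becomes an injective ring
  homomorphism from \<open>ker D\<close> to polynomials over \<open>B\<close>.
\<close>

definition graded :: "'b poly \<Rightarrow> bool" where
  "graded p \<longleftrightarrow> (\<forall>n. D (coeff p n) = 0 \<and> wt (int n) (coeff p n))"

lemma graded_D: "graded p \<Longrightarrow> D (coeff p n) = 0" "graded p \<Longrightarrow> wt (int n) (coeff p n)"
  by (auto simp: graded_def)

lemma graded_exists:
  assumes "D f = 0"
  shows "\<exists>p. graded p \<and> poly p 1 = f"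
proof -
  obtain T g where T: "finite T" "\<forall>d\<in>T. g d \<in> weight_space D U d" "f = (\<Sum>d\<in>T. g d)"
    using pair unfolding fundamental_pair_def by blast
  have wt: "wt d (g d)" if "d \<in> T" for d using T(2) that wt_weight_space by blast
  have "\<forall>d\<in>T. D (g d) = 0"
  proof (rule wt_unique_weights[where g = "\<lambda>d. d + 2"])
    show "(\<Sum>d\<in>T. D (g d)) = 0" using assms T(3) by (simp add: D_simps)
  qed (use T(1) wt wt_D in \<open>auto simp: inj_on_def\<close>)
  then have ker: "D (g d) = 0" if "d \<in> T" for d using that by blast
  define p where "p = (\<Sum>d\<in>{d\<in>T. 0 \<le> d}. monom (g d) (nat d))"
  have coeff: "coeff p n = (if int n \<in> T then g (int n) else 0)" for n :: nat
  proof -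
    have "coeff p n = (\<Sum>d\<in>{d\<in>T. 0 \<le> d}. if int n = d then g d else 0)"
      unfolding p_def coeff_sum by (intro sum.cong) auto
    then show ?thesis using T(1) by simp
  qed
  have "poly p 1 = (\<Sum>d\<in>{d\<in>T. 0 \<le> d}. g d)"
    by (simp add: p_def poly_sum poly_monom)
  also have "\<dots> = f"
    unfolding T(3)
  proof (intro sum.mono_neutral_left ballI)
    fix d assume "d \<in> T - {d \<in> T. 0 \<le> d}"
    then have "d \<in> T" "d < 0" by auto
    then show "g d = 0" using Ker_D_weight_nonneg wt ker by blast
  qed (use T(1) in auto)
  finally have "poly p 1 = f" .
  moreover have "graded p" unfolding graded_def coeff using wt ker by (simp add: D_simps(3))
  ultimately show ?thesis by blast
qed

lemma graded_eq_0:
  assumes "graded p" "poly p 1 = 0"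
  shows "p = 0"
proof -
  have "\<forall>n\<in>{..degree p}. coeff p n = 0"
  proof (rule wt_unique_weights[where g = int])
    show "(\<Sum>n\<le>degree p. coeff p n) = 0" using assms(2) by (simp add: poly_altdef)
  qed (use assms(1) in \<open>auto simp: graded_def\<close>)
  then have "lead_coeff p = 0" by blast
  then show ?thesis by simp
qed

lemma graded_diff: "graded p \<Longrightarrow> graded q \<Longrightarrow> graded (p - q)"
  unfolding graded_def by (metis D_simps(6) diff_self coeff_diff wt_diff)

lemma graded_add: "graded p \<Longrightarrow> graded q \<Longrightarrow> graded (p + q)"
  unfolding graded_def by (metis D_simps(1) add_0 coeff_add wt_add)

lemma graded_mult:
  assumes "graded p" "graded q"
  shows "graded (p * q)"
  unfolding graded_def coeff_mult
proof (intro allI conjI wt_sum)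
  fix n m :: nat assume "m \<in> {..n}"
  then have "int n = int m + int (n - m)" by auto
  then show "wt (int n) (coeff p m * coeff q (n - m))"
    using wt_mult[OF graded_D(2)[OF assms(1), of m] graded_D(2)[OF assms(2), of "n - m"]] by (simp only:)
next
  fix n
  show "D (\<Sum>m\<le>n. coeff p m * coeff q (n - m)) = 0"
    unfolding D_simps(10)
  proof (rule sum.neutral, rule ballI)
    fix m
    show "D (coeff p m * coeff q (n - m)) = 0"
      unfolding D_simps(2) graded_D(1)[OF assms(1)] graded_D(1)[OF assms(2)] by simp
  qed
qed

lemma graded_monom: "D a = 0 \<Longrightarrow> wt (int n) a \<Longrightarrow> graded (monom a n)"
  by (simp add: graded_def D_simps(3))

definition decomp :: "'b \<Rightarrow> 'b poly" where
  "decomp f = (SOME p. graded p \<and> poly p 1 = f)"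

lemma decomp: "D f = 0 \<Longrightarrow> graded (decomp f)" "D f = 0 \<Longrightarrow> poly (decomp f) 1 = f"
  using someI_ex[OF graded_exists[of f]] by (auto simp: decomp_def)

lemma decomp_eqI:
  assumes "graded p" "poly p 1 = f" "D f = 0"
  shows "decomp f = p"
proof -
  have "poly (decomp f - p) 1 = 0" by (simp only: poly_diff decomp(2)[OF assms(3)] assms(2) diff_self)
  from graded_eq_0[OF graded_diff[OF decomp(1)[OF assms(3)] assms(1)] this] show ?thesis by simp
qed

lemma decomp_add: "D a = 0 \<Longrightarrow> D b = 0 \<Longrightarrow> decomp (a + b) = decomp a + decomp b"
  by (rule decomp_eqI) (simp_all add: graded_add decomp D_simps(1))

lemma decomp_mult: "D a = 0 \<Longrightarrow> D b = 0 \<Longrightarrow> decomp (a * b) = decomp a * decomp b"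
  by (rule decomp_eqI) (simp_all add: graded_mult decomp D_simps(2))

lemma decomp_homogeneous: "D a = 0 \<Longrightarrow> wt (int n) a \<Longrightarrow> decomp a = monom a n"
  by (rule decomp_eqI) (simp_all add: graded_monom poly_monom)

text \<open>
  A factor of a homogeneous element is homogeneous, because its image among the polynomials
  divides a monomial.
\<close>

lemma homogeneous_factor:
  assumes "D (a * b) = 0" "wt (int n) (a * b)" "a * b \<noteq> 0"
  shows "\<exists>m m'. n = m + m' \<and> D a = 0 \<and> D b = 0 \<and> wt (int m) a \<and> wt (int m') b"
proof -
  have D: "D a = 0" "D b = 0"
    by (rule LND_factor[OF D_LND assms(3,1)])
      (rule LND_factor[OF D_LND assms(3,1)[unfolded mult.commute[of a b]]])
  have "decomp a * decomp b = monom (a * b) n"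
    using decomp_mult[OF D] decomp_homogeneous[OF assms(1,2)] by simp
  then obtain a' m where "decomp a = monom a' m" using monom_factor assms(3) by blast
  then have "a = a'" "coeff (decomp a) m = a'" using decomp(2)[OF D(1)] by (auto simp: poly_monom)
  then have wa: "wt (int m) a" using graded_D(2)[OF decomp(1)[OF D(1)], of m] by simp
  have "a \<noteq> 0" "b \<noteq> 0" using assms(3) by auto
  then have wb: "wt (int n - int m) b" using wt_mult_cancel[OF assms(2) wa] by simp
  then have "\<not> int n - int m < 0" using Ker_D_weight_nonneg D \<open>b \<noteq> 0\<close> by blast
  then have "n = m + (n - m)" "int n - int m = int (n - m)" by auto
  then show ?thesis using D wa wb by metis
qed

text \<open>
  The retraction of \<open>ker D\<close> onto the invariants.
\<close>

definition inv_part :: "'b \<Rightarrow> 'b" where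
  "inv_part f = coeff (decomp f) 0"

lemma inv_part_add: "D a = 0 \<Longrightarrow> D b = 0 \<Longrightarrow> inv_part (a + b) = inv_part a + inv_part b"
  by (simp add: inv_part_def decomp_add)

lemma inv_part_mult: "D a = 0 \<Longrightarrow> D b = 0 \<Longrightarrow> inv_part (a * b) = inv_part a * inv_part b"
  by (simp add: inv_part_def decomp_mult coeff_mult)

lemma inv_part_id: "D a = 0 \<Longrightarrow> wt 0 a \<Longrightarrow> inv_part a = a"
  using decomp_homogeneous[of a 0] by (simp add: inv_part_def)

lemma inv_part_pos: "D a = 0 \<Longrightarrow> wt (int n) a \<Longrightarrow> n > 0 \<Longrightarrow> inv_part a = 0"
  using decomp_homogeneous[of a n] by (simp add: inv_part_def)

lemma inv_part_i [simp]: "inv_part (i c) = i c"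
  by (rule inv_part_id) auto

lemma D_inv_part [simp]: "D f = 0 \<Longrightarrow> D (inv_part f) = 0"
  and wt_inv_part: "D f = 0 \<Longrightarrow> wt 0 (inv_part f)"
  using graded_D[OF decomp(1), of f 0] by (auto simp: inv_part_def)

lemma inv_part_inv_part: "D f = 0 \<Longrightarrow> inv_part (inv_part f) = inv_part f"
  by (simp add: inv_part_id wt_inv_part)

lemma inv_part_diff: "D a = 0 \<Longrightarrow> D b = 0 \<Longrightarrow> inv_part (a - b) = inv_part a - inv_part b"
  using inv_part_add[of "a - b" b] by (simp add: D_simps)

lemma inv_part_0_components:
  assumes "D f = 0" "inv_part f = 0"
  shows "f = (\<Sum>n\<in>{1..degree (decomp f)}. coeff (decomp f) n)"
proof -
  have "f = (\<Sum>n\<le>degree (decomp f). coeff (decomp f) n)"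
    using decomp(2)[OF assms(1)] by (simp add: poly_altdef)
  also have "\<dots> = (\<Sum>n\<in>{1..degree (decomp f)}. coeff (decomp f) n)"
    using assms(2) by (intro sum.mono_neutral_right) (auto simp: inv_part_def Suc_le_eq intro: gr0I)
  finally show ?thesis .
qed

text \<open>
  For \<open>a\<close> in \<open>ker D\<close> one has \<open>D (U a) = H a\<close>; if \<open>a\<close> has weight 0, then \<open>U a\<close> is an element of
  \<open>ker D\<close> of weight \<open>-2\<close>, hence 0.
\<close>

lemma invariants: "D a = 0 \<Longrightarrow> U a = 0 \<longleftrightarrow> wt 0 a"
proof
  assume "D a = 0" "U a = 0"
  then show "wt 0 a" using DU[of a] by (simp add: wt_def D_simps U_simps)
next
  assume "D a = 0" "wt 0 a"
  then have "D (U a) = 0" using DU[of a] by (simp add: wt_def U_simps)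
  then show "U a = 0" using Ker_D_weight_nonneg[of "-2" "U a"] wt_U[OF \<open>wt 0 a\<close>] by simp
qed

text \<open>
  If \<open>ker D\<close> consists of invariants, then it is \<open>U\<close>-stable and therefore equal to \<open>B\<close>.
\<close>

lemma trivial_if_Ker_D_invariant:
  assumes "\<And>a n. D a = 0 \<Longrightarrow> wt (int n) a \<Longrightarrow> n > 0 \<Longrightarrow> a = 0"
  shows "trivial_pair D U"
proof -
  have Ua: "U a = 0" if "D a = 0" for a
  proof -
    have "coeff (decomp a) n = 0" if "n > 0" for n
      using assms[OF graded_D[OF decomp(1)[OF \<open>D a = 0\<close>]] that] .
    then have "(\<Sum>n\<in>{..degree (decomp a)}. coeff (decomp a) n) = (\<Sum>n\<in>{0}. coeff (decomp a) n)"
      by (intro sum.mono_neutral_right) auto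
    then have "a = inv_part a"
      using decomp(2)[OF \<open>D a = 0\<close>] by (simp add: poly_altdef inv_part_def)
    then show ?thesis using invariants[OF \<open>D a = 0\<close>] wt_inv_part[OF \<open>D a = 0\<close>] by simp
  qed
  have "b \<in> Ker D" for b
    by (rule U_stable_span_of_kernel) (auto simp: Ker_def D_simps Ua)
  then have D: "D b = 0" for b by (simp add: Ker_def)
  then show ?thesis using Ua by (auto simp: trivial_pair_def)
qed

end

section \<open>Prime factorization\<close>

text \<open>
  Prime or a unit or 0.  Admitting 0 makes Nakayama's lemma modulo 0 and modulo a prime instances of
  one statement.
\<close>

definition dvd_prime :: "'b::comm_ring_1 \<Rightarrow> bool" where
  "dvd_prime p \<longleftrightarrow> (\<forall>a b. p dvd a * b \<longrightarrow> p dvd a \<or> p dvd b)"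

lemma dvd_prime_0: "dvd_prime (0::'b::idom)"
  by (simp add: dvd_prime_def)

lemma UFD_prime_factors:
  fixes f :: "'b::idom"
  assumes "factorial_domain (type_ring :: 'b ring)" "f \<noteq> 0"
  shows "\<exists>fs c. f = c * prod_list fs \<and> c dvd 1 \<and> (\<forall>x\<in>set fs. dvd_prime x)"
proof -
  let ?R = "type_ring :: 'b ring"
  let ?G = "mult_of ?R"
  interpret factorial_domain ?R by fact
  have carrier: "carrier ?G = {x. x \<noteq> 0}" and times: "x \<otimes>\<^bsub>?R\<^esub> y = x * y" and one: "\<one>\<^bsub>?R\<^esub> = 1" for x y
    by (auto simp: ring_of_type_algebra_def)
  have divides: "x divides\<^bsub>?G\<^esub> y \<longleftrightarrow> x dvd y" if "y \<noteq> 0" for x y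
    using that by (auto simp: factor_def carrier times dvd_def simp del: carrier_mult_of)
  have "f \<in> carrier ?G" using assms(2) by (simp add: carrier del: carrier_mult_of)
  from wfactors_exist[OF this] obtain fs
    where fs: "set fs \<subseteq> carrier ?G" "wfactors ?G fs f" by blast
  have prime: "dvd_prime x" if "x \<in> set fs" for x
  proof -
    have x: "x \<in> carrier ?G" "Divisibility.irreducible ?G x" using fs that by (auto simp: wfactors_def)
    then have "Divisibility.prime ?G x" by (rule irreducible_prime[rotated])
    then have "x dvd a \<or> x dvd b" if "x dvd a * b" "a \<noteq> 0" "b \<noteq> 0" for a b
      using that by (auto simp: Divisibility.prime_def carrier times divides simp del: carrier_mult_of)
    then show ?thesis unfolding dvd_prime_def by (metis dvd_0_right)
  qed
  have prod: "foldr (\<otimes>\<^bsub>?R\<^esub>) fs \<one>\<^bsub>?R\<^esub> = prod_list fs"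
    by (induction fs) (auto simp: times one)
  have "prod_list fs \<noteq> 0" using fs(1) by (auto simp: carrier prod_list_zero_iff simp del: carrier_mult_of)
  moreover have "prod_list fs \<sim>\<^bsub>?G\<^esub> f" using fs(2) by (simp add: wfactors_def prod)
  ultimately have "prod_list fs dvd f" "f dvd prod_list fs"
    using assms(2) by (auto simp: associated_def divides)
  then obtain c c' where c: "f = prod_list fs * c" "prod_list fs = f * c'" unfolding dvd_def by blast
  then have "prod_list fs * (c * c') = prod_list fs * 1" by (metis mult.assoc mult.right_neutral)
  then have "1 = c * c'" using \<open>prod_list fs \<noteq> 0\<close> by (metis mult_left_cancel)
  then have "c dvd 1" by (rule dvdI)
  then show ?thesis using c(1) prime by (auto simp: mult.commute)
qed

section \<open>Graded coordinates on the kernel\<close>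

locale sl2_plane = sl2_pair i D U for i :: "'k::field_char_0 \<Rightarrow> 'b::idom" and D U +
  fixes h :: "'b \<Rightarrow> (2, 'k) mpol"
  assumes h_iso: "h \<in> alg_iso (type_ring\<lparr>carrier := Ker D\<rparr>) i type_ring Const"
begin

lemma h_add: "D a = 0 \<Longrightarrow> D b = 0 \<Longrightarrow> h (a + b) = h a + h b"
  and h_mult: "D a = 0 \<Longrightarrow> D b = 0 \<Longrightarrow> h (a * b) = h a * h b"
  and h_i: "h (i c) = Const c"
  and h_bij: "bij_betw h (Ker D) UNIV"
  using h_iso by (auto simp: alg_iso_def ring_iso_def ring_hom_def ring_of_type_algebra_def Ker_def)

definition coord :: "2 \<Rightarrow> 'b" where
  "coord v = inv_into (Ker D) h (Var v)"

lemma h_coord: "h (coord v) = Var v" and D_coord [simp]: "D (coord v) = 0"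
proof -
  have "Var v \<in> h ` Ker D" using h_bij by (simp add: bij_betw_def)
  then show "h (coord v) = Var v" "D (coord v) = 0"
    unfolding coord_def using f_inv_into_f[of "Var v" h "Ker D"] inv_into_into[of "Var v" h "Ker D"]
    by (auto simp: Ker_def)
qed

lemma h_inj: "D a = 0 \<Longrightarrow> D b = 0 \<Longrightarrow> h a = h b \<Longrightarrow> a = b"
  using h_bij by (auto simp: bij_betw_def inj_on_def Ker_def)

text \<open>
  The isomorphism \<open>h\<close> makes \<open>ker D\<close> a polynomial ring in the two elements \<open>coord v\<close>.
\<close>

lemma Ker_D_induct [consumes 1, case_names const add coord]:
  assumes "D f = 0"
    and const: "\<And>c. Q (i c)"
    and add: "\<And>a b. D a = 0 \<Longrightarrow> D b = 0 \<Longrightarrow> Q a \<Longrightarrow> Q b \<Longrightarrow> Q (a + b)"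
    and coord: "\<And>v a. D a = 0 \<Longrightarrow> Q a \<Longrightarrow> Q (coord v * a)"
  shows "Q f"
proof -
  have "\<exists>a. D a = 0 \<and> h a = p \<and> Q a" for p
  proof (induction p rule: mpol_induct)
    case (const c)
    then show ?case using h_i assms(2) by (intro exI[of _ "i c"]) auto
  next
    case (add p q)
    then obtain a b where "D a = 0" "h a = p" "Q a" "D b = 0" "h b = q" "Q b" by blast
    then show ?case using assms(3) h_add by (intro exI[of _ "a + b"]) (auto simp: D_simps)
  next
    case (var v p)
    then obtain a where "D a = 0" "h a = p" "Q a" by blast
    then show ?case using assms(4) h_mult by (intro exI[of _ "coord v * a"]) (auto simp: D_simps h_coord)
  qed
  then show ?thesis using h_inj[OF _ assms(1)] by metis
qed

definition hom_on_Ker :: "('b \<Rightarrow> 'r::comm_ring_1) \<Rightarrow> ('k \<Rightarrow> 'r) \<Rightarrow> bool" where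
  "hom_on_Ker t j \<longleftrightarrow> is_hom j \<and> (\<forall>c. t (i c) = j c) \<and>
     (\<forall>a b. D a = 0 \<longrightarrow> D b = 0 \<longrightarrow> t (a + b) = t a + t b \<and> t (a * b) = t a * t b)"

lemma hom_on_Ker_simps:
  assumes "hom_on_Ker t j"
  shows "t (i c) = j c" "t 0 = 0" "t 1 = 1" "D a = 0 \<Longrightarrow> D b = 0 \<Longrightarrow> t (a + b) = t a + t b"
    "D a = 0 \<Longrightarrow> D b = 0 \<Longrightarrow> t (a * b) = t a * t b"
    "D a = 0 \<Longrightarrow> D b = 0 \<Longrightarrow> t (a - b) = t a - t b"
proof -
  have j: "is_hom j" and i: "t (i c) = j c" for c using assms by (auto simp: hom_on_Ker_def)
  show "t (i c) = j c" by (rule i)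
  show "t 0 = 0" "t 1 = 1" using i[of 0] i[of 1] by (auto simp: i_simps is_hom_simps[OF j])
  show add: "t (a + b) = t a + t b" if "D a = 0" "D b = 0" for a b
    using assms that by (auto simp: hom_on_Ker_def)
  show "t (a * b) = t a * t b" if "D a = 0" "D b = 0" for a b
    using assms that by (auto simp: hom_on_Ker_def)
  show "t (a - b) = t a - t b" if "D a = 0" "D b = 0" for a b
    using add[of "a - b" b] that by (simp add: D_simps)
qed

lemma hom_on_Ker_exists:
  fixes x :: "2 \<Rightarrow> 'r::comm_ring_1"
  assumes "is_hom j"
  obtains t where "hom_on_Ker t j" "\<And>v. t (coord v) = x v"
proof
  show "hom_on_Ker (\<lambda>a. mpol_eval j x (h a)) j"
    using assms by (simp add: hom_on_Ker_def h_i h_add h_mult mpol_eval_Const is_hom_simps[OF mpol_eval_hom])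
  show "mpol_eval j x (h (coord v)) = x v" for v
    by (simp add: h_coord mpol_eval_Var assms)
qed

text \<open>
  The total degree in the two coordinates.  It is realized as the degree in \<open>T\<close> after the
  substitution \<open>coord v \<mapsto> coord v \<cdot> T\<close>, a homomorphism to a polynomial ring over the domain
  \<open>B\<close>, so that it is additive on products.
\<close>

lemma degree_descent:
  obtains deg :: "'b \<Rightarrow> nat"
  where "deg 0 = 0"
    "\<And>c p g. D p = 0 \<Longrightarrow> D g = 0 \<Longrightarrow> g \<noteq> 0 \<Longrightarrow> p \<notin> range i \<Longrightarrow> deg g < deg (i c + p * g)"
proof -
  define j :: "'k \<Rightarrow> 'b poly" where "j c = [:i c:]" for c
  have j: "is_hom j" unfolding is_hom_def j_def by (auto simp: i_simps one_pCons)
  obtain t where t: "hom_on_Ker t j" "\<And>v. t (coord v) = monom (coord v) 1"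
    using hom_on_Ker_exists[OF j, of "\<lambda>v. monom (coord v) 1"] by blast
  note ts = hom_on_Ker_simps[OF t(1)]
  have at1: "poly (t f) 1 = f" if "D f = 0" for f
    using that by (induction rule: Ker_D_induct) (simp_all add: ts t(2) j_def poly_monom)
  have at0: "coeff (t f) 0 \<in> range i" if "D f = 0" for f
    using that
  proof (induction rule: Ker_D_induct)
    case (add a b)
    then show ?case by (auto simp: ts simp flip: i_simps)
  next
    case (coord v a)
    then have "coeff (t (coord v * a)) 0 = i 0" by (simp add: ts t(2) coeff_mult i_simps)
    then show ?case by (metis rangeI)
  qed (simp add: ts j_def)
  have "degree (t g) < degree (t (i c + p * g))" if "D p = 0" "D g = 0" "g \<noteq> 0" "p \<notin> range i" for c p g
  proof -
    have "t g \<noteq> 0" using at1[OF that(2)] that(3) by auto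
    have "degree (t p) \<noteq> 0"
    proof
      assume "degree (t p) = 0"
      then obtain a where "t p = [:a:]" by (rule degree_eq_zeroE)
      then show False using at0[OF that(1)] at1[OF that(1)] that(4) by simp
    qed
    then have "t p \<noteq> 0" by auto
    have deg: "degree (t p * t g) = degree (t p) + degree (t g)"
      using \<open>t p \<noteq> 0\<close> \<open>t g \<noteq> 0\<close> by (rule degree_mult_eq)
    have "degree (j c) < degree (t p * t g)"
      using deg \<open>degree (t p) \<noteq> 0\<close> by (simp add: j_def)
    then have "degree (t (i c + p * g)) = degree (t p * t g)"
      using that by (simp add: ts D_simps degree_add_eq_right)
    then show ?thesis using deg \<open>degree (t p) \<noteq> 0\<close> by simp
  qed
  then show ?thesis using that[of "\<lambda>f. degree (t f)"] by (simp add: ts)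
qed

text \<open>
  If \<open>c\<^sub>0 + p g = 0\<close> with \<open>g \<noteq> 0\<close>, then \<open>g\<close> would have smaller degree than the element 0, whose degree
  is 0.
\<close>

lemma transcendental:
  assumes p: "D p = 0" "p \<notin> range i" and "poly (map_poly i c) p = 0"
  shows "c = 0"
proof -
  obtain deg :: "'b \<Rightarrow> nat" where deg: "deg 0 = 0"
    "\<And>c p g. D p = 0 \<Longrightarrow> D g = 0 \<Longrightarrow> g \<noteq> 0 \<Longrightarrow> p \<notin> range i \<Longrightarrow> deg g < deg (i c + p * g)"
    by (rule degree_descent) blast
  have D_poly: "D (poly (map_poly i c) p) = 0" for c
    by (induction c) (auto simp: map_poly_pCons i_simps D_simps p(1))
  show ?thesis using assms(3)
  proof (induction c)
    case (pCons c0 c)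
    let ?g = "poly (map_poly i c) p"
    have eq: "i c0 + p * ?g = 0" using pCons.prems by (simp add: map_poly_pCons i_simps)
    have "?g = 0"
    proof (rule ccontr)
      assume "?g \<noteq> 0"
      then have "deg ?g < deg (i c0 + p * ?g)" by (intro deg(2) p D_poly)
      then show False unfolding eq deg(1) by simp
    qed
    then show ?case using pCons.IH eq by (simp add: i_eq_0_iff)
  qed simp
qed

end

lemma cramer:
  fixes w1 w2 x1 x2 f1 f2 :: "'c::field"
  assumes "w1 * x2 - w2 * x1 \<noteq> 0"
  shows "\<exists>a b. f1 = a * w1 + b * x1 \<and> f2 = a * w2 + b * x2"
proof -
  let ?d = "w1 * x2 - w2 * x1"
  have "f1 = (f1 * x2 - f2 * x1) / ?d * w1 + (w1 * f2 - w2 * f1) / ?d * x1"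
    "f2 = (f1 * x2 - f2 * x1) / ?d * w2 + (w1 * f2 - w2 * f1) / ?d * x2"
    using assms by (simp_all add: divide_simps) (simp_all add: algebra_simps)
  then show ?thesis by blast
qed

text \<open>
  Coordinates \<open>u\<close>, \<open>v\<close> of the plane \<open>Spec (ker D)\<close> centred at a rational point \<open>pt\<close> which is fixed by
  the retraction onto the invariants, together with the two partial derivatives \<open>d1\<close>, \<open>d2\<close> at
  that point.  The last assumption says that the kernel of the retraction is generated by
  \<open>u - inv_part u\<close> and \<open>v - inv_part v\<close>, and \<open>expand\<close> says that \<open>u\<close> and \<open>v\<close> generate the maximal
  ideal of the point.
\<close>

locale pointed_plane = sl2_plane i D U h
  for i :: "'k::field_char_0 \<Rightarrow> 'b::idom" and D U and h :: "'b \<Rightarrow> (2, 'k) mpol" +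
  fixes u v :: 'b and pt d1 d2 :: "'b \<Rightarrow> 'k"
  assumes D_uv [simp]: "D u = 0" "D v = 0"
    and pt_i [simp]: "pt (i c) = c"
    and pt_add: "D a = 0 \<Longrightarrow> D b = 0 \<Longrightarrow> pt (a + b) = pt a + pt b"
    and pt_mult: "D a = 0 \<Longrightarrow> D b = 0 \<Longrightarrow> pt (a * b) = pt a * pt b"
    and pt_inv_part [simp]: "D a = 0 \<Longrightarrow> pt (inv_part a) = pt a"
    and d_i [simp]: "d1 (i c) = 0" "d2 (i c) = 0"
    and d_add: "D a = 0 \<Longrightarrow> D b = 0 \<Longrightarrow> d1 (a + b) = d1 a + d1 b"
      "D a = 0 \<Longrightarrow> D b = 0 \<Longrightarrow> d2 (a + b) = d2 a + d2 b"
    and d_mult: "D a = 0 \<Longrightarrow> D b = 0 \<Longrightarrow> d1 (a * b) = pt a * d1 b + d1 a * pt b"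
      "D a = 0 \<Longrightarrow> D b = 0 \<Longrightarrow> d2 (a * b) = pt a * d2 b + d2 a * pt b"
    and at_uv [simp]: "pt u = 0" "pt v = 0" "d1 u = 1" "d1 v = 0" "d2 u = 0" "d2 v = 1"
    and expand: "D f = 0 \<Longrightarrow> \<exists>a b. D a = 0 \<and> D b = 0 \<and> f = i (pt f) + u * a + v * b"
    and expand_positive: "D f = 0 \<Longrightarrow> \<exists>a b. D a = 0 \<and> D b = 0 \<and>
      f - inv_part f = (u - inv_part u) * a + (v - inv_part v) * b"
begin

lemma pt_0 [simp]: "pt 0 = 0" "pt 1 = 1"
  using pt_i[of 0] pt_i[of 1] by (auto simp: i_simps)

lemma pt_diff: "D a = 0 \<Longrightarrow> D b = 0 \<Longrightarrow> pt (a - b) = pt a - pt b"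
  using pt_add[of "a - b" b] by (simp add: D_simps)

lemma d_diff: "D a = 0 \<Longrightarrow> D b = 0 \<Longrightarrow> d1 (a - b) = d1 a - d1 b"
  "D a = 0 \<Longrightarrow> D b = 0 \<Longrightarrow> d2 (a - b) = d2 a - d2 b"
  using d_add(1)[of "a - b" b] d_add(2)[of "a - b" b] by (simp_all add: D_simps)

lemma d_sum_0:
  assumes "\<And>t. t \<in> T \<Longrightarrow> D (f t) = 0 \<and> d1 (f t) = 0 \<and> d2 (f t) = 0"
  shows "d1 (\<Sum>t\<in>T. f t) = 0 \<and> d2 (\<Sum>t\<in>T. f t) = 0"
proof -
  have "D (\<Sum>t\<in>T. f t) = 0 \<and> d1 (\<Sum>t\<in>T. f t) = 0 \<and> d2 (\<Sum>t\<in>T. f t) = 0"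
    using assms
  proof (induction T rule: infinite_finite_induct)
    case (insert t T)
    then show ?case by (auto simp: D_simps d_add)
  qed (use d_i[of 0] in \<open>auto simp: D_simps i_simps\<close>)
  then show ?thesis by blast
qed

lemmas pt_simps = pt_add pt_mult pt_diff d_add d_mult d_diff

lemma pt_inv_part_eq_0: "D f = 0 \<Longrightarrow> inv_part f = 0 \<Longrightarrow> pt f = 0"
  using pt_inv_part[of f] by simp

text \<open>
  An element that vanishes at the point together with its differential lies in the square of the
  maximal ideal.  The next lemmas refine this along the grading: its invariant part lies in the
  square of the maximal ideal of the invariants, and if the invariant part is 0, then the element
  lies in the product of the maximal ideal and the kernel of the retraction.
\<close>

lemma second_order:
  assumes "D f = 0" "pt f = 0" "d1 f = 0" "d2 f = 0"
  obtains a b where "D a = 0" "D b = 0" "pt a = 0" "pt b = 0" "f = u * a + v * b"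
proof -
  obtain a b where ab: "D a = 0" "D b = 0" "f = i (pt f) + u * a + v * b" using expand assms(1) by blast
  then have f: "f = u * a + v * b" using assms(2) by (simp add: i_simps)
  have "d1 f = pt a" "d2 f = pt b" unfolding f using ab by (simp_all add: pt_simps D_simps)
  then show ?thesis using that ab f assms by simp
qed

lemma second_order_inv_part:
  assumes "D f = 0" "pt f = 0" "d1 f = 0" "d2 f = 0"
  obtains a b where "D a = 0" "D b = 0" "wt 0 a" "wt 0 b" "pt a = 0" "pt b = 0"
    "inv_part f = inv_part u * a + inv_part v * b"
proof -
  obtain a b where ab: "D a = 0" "D b = 0" "pt a = 0" "pt b = 0" "f = u * a + v * b"
    using second_order[OF assms] .
  then have "inv_part f = inv_part u * inv_part a + inv_part v * inv_part b"
    by (simp add: inv_part_add inv_part_mult D_simps)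
  then show ?thesis using that[of "inv_part a" "inv_part b"] ab by (simp add: wt_inv_part)
qed

lemma d_inv_part_eq_0:
  assumes "D f = 0" "pt f = 0" "d1 f = 0" "d2 f = 0"
  shows "d1 (inv_part f) = 0" "d2 (inv_part f) = 0"
proof -
  obtain a b where "D a = 0" "D b = 0" "wt 0 a" "wt 0 b" "pt a = 0" "pt b = 0"
    "inv_part f = inv_part u * a + inv_part v * b"
    using second_order_inv_part[OF assms] .
  then show "d1 (inv_part f) = 0" "d2 (inv_part f) = 0" by (simp_all add: pt_simps D_simps)
qed

lemma second_order_positive:
  assumes f: "D f = 0" "inv_part f = 0" "d1 f = 0" "d2 f = 0"
  obtains a b where "D a = 0" "D b = 0" "pt a = 0" "pt b = 0"
    "f = (u - inv_part u) * a + (v - inv_part v) * b"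
proof -
  have "pt f = 0" using pt_inv_part_eq_0 f by simp
  then obtain a b where ab: "D a = 0" "D b = 0" "pt a = 0" "pt b = 0" "f = u * a + v * b"
    using second_order f by blast
  obtain s t where s: "D s = 0" "D t = 0"
    "a - inv_part a = (u - inv_part u) * s + (v - inv_part v) * t" using expand_positive ab(1) by blast
  obtain s' t' where s': "D s' = 0" "D t' = 0"
    "b - inv_part b = (u - inv_part u) * s' + (v - inv_part v) * t'" using expand_positive ab(2) by blast
  have "f = f - inv_part f" using f(2) by simp
  also have "\<dots> = u * a + v * b - (inv_part u * inv_part a + inv_part v * inv_part b)"
    using ab by (simp add: inv_part_add inv_part_mult D_simps)
  also have "\<dots> = (u - inv_part u) * a + (v - inv_part v) * b
      + inv_part u * (a - inv_part a) + inv_part v * (b - inv_part b)"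
    by (simp add: algebra_simps)
  also have "\<dots> = (u - inv_part u) * (a + inv_part u * s + inv_part v * s')
      + (v - inv_part v) * (b + inv_part u * t + inv_part v * t')"
    unfolding s(3) s'(3) by (simp add: algebra_simps)
  finally show ?thesis
    using that[of "a + inv_part u * s + inv_part v * s'" "b + inv_part u * t + inv_part v * t'"] ab s s'
    by (simp add: D_simps pt_simps)
qed

lemma dvd_imp_pt_0:
  assumes "p dvd f" "D p = 0" "pt p = 0" "D f = 0"
  shows "pt f = 0"
proof (cases "f = 0")
  case False
  obtain g where g: "f = p * g" using assms(1) by (auto simp: dvd_def)
  then have "D g = 0" using Ker_D_mult_cancel[of p g] assms False by auto
  then show ?thesis using g assms by (simp add: pt_mult)
qed simp

text \<open>
  Nakayama's lemma for a module with two generators, modulo \<open>p\<close>, by the determinant trick: the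
  determinant \<open>e\<close> of the linear system takes the value 1 at the point, so that \<open>p\<close> does not divide
  it, while \<open>p\<close> divides \<open>e s\<close> and \<open>e t\<close>.
\<close>

lemma nakayama:
  assumes p: "dvd_prime p" "D p = 0" "pt p = 0"
    and D: "D s = 0" "D t = 0" "D a = 0" "D b = 0" "D c = 0" "D d = 0"
    and pt: "pt a = 0" "pt b = 0" "pt c = 0" "pt d = 0"
    and s: "p dvd s - (s * a + t * b)" and t: "p dvd t - (s * c + t * d)"
  shows "p dvd s" "p dvd t"
proof -
  define e where "e = (1 - a) * (1 - d) - b * c"
  have "D e = 0" "pt e = 1"
    using D pt by (simp_all add: e_def pt_simps D_simps)
  then have "\<not> p dvd e" using dvd_imp_pt_0[of p e] p by auto
  have "e * s = (s - (s * a + t * b)) * (1 - d) + (t - (s * c + t * d)) * b"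
    by (simp add: e_def algebra_simps)
  then have "p dvd e * s" using s t by simp
  then show "p dvd s" using p(1) \<open>\<not> p dvd e\<close> by (auto simp: dvd_prime_def)
  have "e * t = (s - (s * a + t * b)) * c + (t - (s * c + t * d)) * (1 - a)"
    by (simp add: e_def algebra_simps)
  then have "p dvd e * t" using s t by simp
  then show "p dvd t" using p(1) \<open>\<not> p dvd e\<close> by (auto simp: dvd_prime_def)
qed

text \<open>
  A product vanishes at the point only if a factor does, so some prime factor of \<open>f\<close> vanishes there.
\<close>

lemma prime_factor_at_point:
  assumes "factorial_domain (type_ring :: 'b ring)" "D f = 0" "f \<noteq> 0" "pt f = 0"
  obtains p g where "f = p * g" "dvd_prime p" "D p = 0" "D g = 0" "pt p = 0"
proof -
  obtain fs c where f: "f = c * prod_list fs" "c dvd 1" "\<forall>x\<in>set fs. dvd_prime x"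
    using UFD_prime_factors[OF assms(1,3)] by blast
  have D: "D c = 0" "D (prod_list fs) = 0"
    using LND_factor[OF D_LND, of c "prod_list fs"] LND_factor[OF D_LND, of "prod_list fs" c] assms(2,3)
    by (simp_all add: f(1) mult.commute)
  obtain c' where c': "1 = c * c'" using f(2) by (auto simp: dvd_def)
  then have "D c' = 0" using LND_factor[OF D_LND, of c' c] by (simp add: mult.commute D_simps)
  then have "pt c * pt c' = 1" using pt_mult[OF D(1), of c'] c' by simp
  then have "pt (prod_list fs) = 0" using assms(4) pt_mult[OF D] by (auto simp: f(1))
  have "\<exists>p g. prod_list fs = p * g \<and> p \<in> set fs \<and> D p = 0 \<and> D g = 0 \<and> pt p = 0"
    if "prod_list fs \<noteq> 0" "D (prod_list fs) = 0" "pt (prod_list fs) = 0"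
    using that
  proof (induction fs)
    case (Cons x fs)
    have Dx: "D x = 0" "D (prod_list fs) = 0"
      using LND_factor[OF D_LND, of x "prod_list fs"] LND_factor[OF D_LND, of "prod_list fs" x] Cons.prems
      by (simp_all add: mult.commute)
    show ?case
    proof (cases "pt x = 0")
      case True
      then show ?thesis using Dx by (intro exI[of _ x] exI[of _ "prod_list fs"]) simp
    next
      case False
      then have "pt (prod_list fs) = 0" using Cons.prems(3) pt_mult[OF Dx] by simp
      then obtain p g where "prod_list fs = p * g" "p \<in> set fs" "D p = 0" "D g = 0" "pt p = 0"
        using Cons Dx by auto
      then show ?thesis using Dx by (intro exI[of _ p] exI[of _ "x * g"]) (simp add: D_simps)
    qed
  qed simp
  then obtain p g where "prod_list fs = p * g" "p \<in> set fs" "D p = 0" "D g = 0" "pt p = 0"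
    using assms(3) f(1) D \<open>pt (prod_list fs) = 0\<close> by auto
  then show ?thesis using that[of p "c * g"] f D by (simp add: D_simps)
qed

end

context sl2_plane
begin

text \<open>
  The point is the image of the origin under the retraction: its value at \<open>f\<close> is the value of
  \<open>inv_part f\<close> at the origin.  The partial derivatives are the linear coefficients of the
  homomorphisms to \<open>k[T]\<close> that move the point along one of the coordinate axes.
\<close>

lemma pointed_plane_exists:
  "\<exists>u v pt d1 d2. pointed_plane i D U h u v pt d1 d2"
proof -
  have two: "w = 0 \<or> w = 1" for w :: 2 using UNIV_2 by auto
  have id: "is_hom (\<lambda>c::'k. c)" by (simp add: is_hom_def)
  obtain e where e: "hom_on_Ker e (\<lambda>c. c)" "\<And>w. e (coord w) = 0"
    using hom_on_Ker_exists[OF id, of "\<lambda>_. 0"] by blast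
  note es = hom_on_Ker_simps[OF e(1)]
  define pt where "pt f = e (inv_part f)" for f
  have pt: "pt (i c) = c" "D a = 0 \<Longrightarrow> D b = 0 \<Longrightarrow> pt (a + b) = pt a + pt b"
    "D a = 0 \<Longrightarrow> D b = 0 \<Longrightarrow> pt (a * b) = pt a * pt b" "D a = 0 \<Longrightarrow> pt (inv_part a) = pt a"
    for a b c
    by (simp_all add: pt_def es inv_part_add inv_part_mult inv_part_inv_part)
  define x where "x w = coord w - i (pt (coord w))" for w
  have D_x: "D (x w) = 0" for w by (simp add: x_def D_simps)
  have coord_eq: "coord w = x w + i (pt (coord w))" for w by (simp add: x_def)
  define j :: "'k \<Rightarrow> 'k poly" where "j c = [:c:]" for c
  have j: "is_hom j" unfolding is_hom_def j_def by (simp add: one_pCons)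
  have "\<exists>t. hom_on_Ker t j \<and> (\<forall>w'. t (coord w') = [:pt (coord w'), if w' = w then 1 else 0:])" for w
    using hom_on_Ker_exists[OF j, of "\<lambda>w'. [:pt (coord w'), if w' = w then 1 else 0:]"] by metis
  then obtain t where t: "\<And>w. hom_on_Ker (t w) j"
    "\<And>w w'. t w (coord w') = [:pt (coord w'), if w' = w then 1 else 0:]" by metis
  note ts = hom_on_Ker_simps[OF t(1)]
  have t0: "coeff (t w f) 0 = pt f" if "D f = 0" for f w
    using that by (induction rule: Ker_D_induct) (simp_all add: ts t(2) j_def pt coeff_mult)
  define d where "d w f = coeff (t w f) 1" for w f
  have d: "d w (i c) = 0" "D a = 0 \<Longrightarrow> D b = 0 \<Longrightarrow> d w (a + b) = d w a + d w b"
    "D a = 0 \<Longrightarrow> D b = 0 \<Longrightarrow> d w (a * b) = pt a * d w b + d w a * pt b" for w a b c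
    by (simp_all add: d_def ts j_def coeff_mult t0)
  have d_x: "d w (x w') = (if w' = w then 1 else 0)" for w w'
    by (simp add: x_def d_def ts j_def t(2))
  have expand: "\<exists>a b. D a = 0 \<and> D b = 0 \<and> f = i (pt f) + x 0 * a + x 1 * b" if "D f = 0" for f
    using that
  proof (induction rule: Ker_D_induct)
    case (const c)
    show ?case by (intro exI[of _ 0]) (simp add: D_simps pt)
  next
    case (add f g)
    then obtain a b a' b' where *: "D a = 0" "D b = 0" "f = i (pt f) + x 0 * a + x 1 * b"
      "D a' = 0" "D b' = 0" "g = i (pt g) + x 0 * a' + x 1 * b'" by blast
    have "f + g = (i (pt f) + x 0 * a + x 1 * b) + (i (pt g) + x 0 * a' + x 1 * b')"
      using *(3,6) by (rule arg_cong2)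
    also have "\<dots> = i (pt (f + g)) + x 0 * (a + a') + x 1 * (b + b')"
      using add(1,2) by (simp add: pt i_simps algebra_simps)
    finally show ?case using *(1,2,4,5) by (intro exI[of _ "a + a'"] exI[of _ "b + b'"]) (simp add: D_simps)
  next
    case (coord w f)
    then obtain a b where *: "D a = 0" "D b = 0" "f = i (pt f) + x 0 * a + x 1 * b" by blast
    let ?c = "i (pt (coord w))"
    have "coord w * f = ?c * f + x w * f" by (simp add: x_def algebra_simps)
    also have "\<dots> = ?c * (i (pt f) + x 0 * a + x 1 * b) + x w * f" using *(3) by (rule arg_cong)
    also have "\<dots> = i (pt (coord w * f)) + x 0 * (?c * a) + x 1 * (?c * b) + x w * f"
      using coord(1) by (simp add: pt i_simps algebra_simps)
    finally have eq: "coord w * f = \<dots>" .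
    show ?case
    proof (cases "w = 0")
      case True
      have "coord w * f = i (pt (coord w * f)) + x 0 * (?c * a + f) + x 1 * (?c * b)"
        by (subst eq) (simp add: True algebra_simps)
      then show ?thesis using *(1,2) coord(1)
        by (intro exI[of _ "?c * a + f"] exI[of _ "?c * b"]) (simp add: D_simps)
    next
      case False
      then have "w = 1" using two by blast
      then have "coord w * f = i (pt (coord w * f)) + x 0 * (?c * a) + x 1 * (?c * b + f)"
        by (subst eq) (simp add: algebra_simps)
      then show ?thesis using *(1,2) coord(1)
        by (intro exI[of _ "?c * a"] exI[of _ "?c * b + f"]) (simp add: D_simps)
    qed
  qed
  have x_pos: "x w - inv_part (x w) = coord w - inv_part (coord w)" for w
    by (simp add: x_def inv_part_diff)
  have positive: "\<exists>a b. D a = 0 \<and> D b = 0 \<and>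
      f - inv_part f = (x 0 - inv_part (x 0)) * a + (x 1 - inv_part (x 1)) * b" if "D f = 0" for f
    using that unfolding x_pos
  proof (induction rule: Ker_D_induct)
    case (const c)
    show ?case by (intro exI[of _ 0]) (simp add: D_simps)
  next
    case (add f g)
    let ?r = "\<lambda>a b. (coord 0 - inv_part (coord 0)) * a + (coord 1 - inv_part (coord 1)) * b"
    obtain a b a' b' where *: "D a = 0" "D b = 0" "f - inv_part f = ?r a b"
      "D a' = 0" "D b' = 0" "g - inv_part g = ?r a' b'" using add by blast
    have "f + g - inv_part (f + g) = (f - inv_part f) + (g - inv_part g)"
      using add(1,2) by (simp add: inv_part_add)
    also have "\<dots> = ?r (a + a') (b + b')" unfolding *(3,6) by (simp add: algebra_simps)
    finally show ?case using *(1,2,4,5) by (intro exI[of _ "a + a'"] exI[of _ "b + b'"]) (simp add: D_simps)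
  next
    case (coord w f)
    let ?r = "\<lambda>a b. (coord 0 - inv_part (coord 0)) * a + (coord 1 - inv_part (coord 1)) * b"
    obtain a b where *: "D a = 0" "D b = 0" "f - inv_part f = ?r a b" using coord by blast
    let ?c = "inv_part (coord w)"
    have "coord w * f - inv_part (coord w * f) = ?c * (f - inv_part f) + (coord w - ?c) * f"
      using coord(1) by (simp add: inv_part_mult algebra_simps)
    also have "\<dots> = ?c * ?r a b + (coord w - ?c) * f" by (simp only: *(3))
    also have "\<dots> = (if w = 0 then ?r (?c * a + f) (?c * b) else ?r (?c * a) (?c * b + f))"
      using two[of w] by (auto simp: algebra_simps)
    finally have eq: "coord w * f - inv_part (coord w * f)
      = ?r (if w = 0 then ?c * a + f else ?c * a) (if w = 0 then ?c * b else ?c * b + f)"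
      by (simp split: if_splits)
    show ?case
      by (rule exI, rule exI, intro conjI, rule_tac [3] eq) (use *(1,2) coord(1) in \<open>auto simp: D_simps\<close>)
  qed
  have "pointed_plane i D U h (x 0) (x 1) pt (d 0) (d 1)"
    by (unfold_locales; (intro d pt D_x expand positive; assumption)?)
      (simp_all add: pt d_x, simp_all add: x_def pt_def es inv_part_diff e(2))
  then show ?thesis by blast
qed

end

context pointed_plane
begin

text \<open>
  Otherwise the maximal ideal of the invariants at the point would equal its square, so it would
  vanish by Nakayama's lemma, and the only invariants would be the constants.
\<close>

lemma invariant_tangent_exists:
  assumes "Ker D \<inter> Ker U \<noteq> range i"
  shows "\<exists>w. D w = 0 \<and> wt 0 w \<and> pt w = 0 \<and> \<not> (d1 w = 0 \<and> d2 w = 0)"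
proof (rule ccontr)
  assume none: "\<not> ?thesis"
  have lin: "d1 w = 0" "d2 w = 0" if "D w = 0" "wt 0 w" "pt w = 0" for w
    using none that by blast+
  define u0 v0 where "u0 = inv_part u" and "v0 = inv_part v"
  have uv: "D u0 = 0" "wt 0 u0" "pt u0 = 0" "D v0 = 0" "wt 0 v0" "pt v0 = 0"
    by (simp_all add: u0_def v0_def wt_inv_part)
  obtain a b where a: "D a = 0" "D b = 0" "pt a = 0" "pt b = 0" "inv_part u0 = u0 * a + v0 * b"
    using second_order_inv_part[OF uv(1,3) lin[OF uv(1-3)]] unfolding u0_def v0_def .
  obtain c d where c: "D c = 0" "D d = 0" "pt c = 0" "pt d = 0" "inv_part v0 = u0 * c + v0 * d"
    using second_order_inv_part[OF uv(4,6) lin[OF uv(4-6)]] unfolding u0_def v0_def .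
  have "u0 - (u0 * a + v0 * b) = 0" "v0 - (u0 * c + v0 * d) = 0"
    unfolding a(5)[symmetric] c(5)[symmetric] by (simp_all only: inv_part_id uv diff_self)
  then have "0 dvd u0 - (u0 * a + v0 * b)" "0 dvd v0 - (u0 * c + v0 * d)" by simp_all
  note nakayama[OF dvd_prime_0 D_simps(3) pt_0(1) uv(1,4) a(1,2) c(1,2) a(3,4) c(3,4) this]
  then have zero: "inv_part u = 0" "inv_part v = 0" by (auto simp: u0_def v0_def)
  have "f \<in> range i" if inv: "D f = 0" "wt 0 f" for f
  proof -
    obtain a b where "D a = 0" "D b = 0" and f: "f = i (pt f) + u * a + v * b"
      using expand[OF inv(1)] by blast
    have "inv_part f = inv_part (i (pt f) + u * a + v * b)" by (rule arg_cong[OF f])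
    also have "\<dots> = i (pt f)"
      using \<open>D a = 0\<close> \<open>D b = 0\<close> zero by (simp add: inv_part_add inv_part_mult D_simps)
    finally show ?thesis unfolding inv_part_id[OF inv] by simp
  qed
  then have "Ker D \<inter> Ker U = range i" using invariants by (auto simp: Ker_def)
  then show False using assms by contradiction
qed

text \<open>
  Otherwise the kernel \<open>I\<close> of the retraction would be contained in the product of \<open>I\<close> and the maximal
  ideal, so \<open>I = 0\<close> by Nakayama's lemma.
\<close>

lemma positive_tangent_exists:
  assumes "\<not> trivial_pair D U"
  shows "\<exists>x n. D x = 0 \<and> wt (int n) x \<and> n > 0 \<and> \<not> (d1 x = 0 \<and> d2 x = 0)"
proof (rule ccontr)
  assume none: "\<not> ?thesis"
  have lin: "d1 f = 0 \<and> d2 f = 0" if f: "D f = 0" "inv_part f = 0" for f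
  proof -
    have "d1 (\<Sum>n\<in>{1..degree (decomp f)}. coeff (decomp f) n) = 0
        \<and> d2 (\<Sum>n\<in>{1..degree (decomp f)}. coeff (decomp f) n) = 0"
    proof (rule d_sum_0)
      fix n assume "n \<in> {1..degree (decomp f)}"
      then show "D (coeff (decomp f) n) = 0 \<and> d1 (coeff (decomp f) n) = 0 \<and> d2 (coeff (decomp f) n) = 0"
        using none graded_D[OF decomp(1)[OF f(1)], of n] by force
    qed
    then show ?thesis using inv_part_0_components[OF f] by simp
  qed
  define u' v' where "u' = u - inv_part u" and "v' = v - inv_part v"
  have uv: "D u' = 0" "inv_part u' = 0" "D v' = 0" "inv_part v' = 0"
    by (simp_all add: u'_def v'_def D_simps inv_part_diff inv_part_inv_part)
  obtain a b where a: "D a = 0" "D b = 0" "pt a = 0" "pt b = 0" "u' = u' * a + v' * b"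
    using second_order_positive[OF uv(1,2) lin[OF uv(1,2), THEN conjunct1] lin[OF uv(1,2), THEN conjunct2]]
    unfolding u'_def v'_def .
  obtain c d where c: "D c = 0" "D d = 0" "pt c = 0" "pt d = 0" "v' = u' * c + v' * d"
    using second_order_positive[OF uv(3,4) lin[OF uv(3,4), THEN conjunct1] lin[OF uv(3,4), THEN conjunct2]]
    unfolding u'_def v'_def .
  have "0 dvd u' - (u' * a + v' * b)" "0 dvd v' - (u' * c + v' * d)"
    unfolding a(5)[symmetric] c(5)[symmetric] by simp_all
  note nakayama[OF dvd_prime_0 D_simps(3) pt_0(1) uv(1,3) a(1,2) c(1,2) a(3,4) c(3,4) this]
  then have zero: "u - inv_part u = 0" "v - inv_part v = 0" by (auto simp: u'_def v'_def)
  have "f = 0" if "D f = 0" "wt (int n) f" "n > 0" for f n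
    using expand_positive[OF that(1)] unfolding zero inv_part_pos[OF that] by auto
  then have "trivial_pair D U" by (rule trivial_if_Ker_D_invariant)
  then show False using assms by contradiction
qed

text \<open>
  The differentials of an invariant \<open>w\<close> and of an element \<open>x\<close> of positive weight form a basis
  of the cotangent plane, since the grading separates them.  So modulo second order every
  invariant that vanishes at the point is a multiple of \<open>w\<close>, and every element without invariant part
  is a multiple of \<open>x\<close>.  Nakayama's lemma modulo a prime factor \<open>p\<close> of \<open>w\<close>, or \<open>q\<close> of \<open>x\<close>, turns this
  into divisibility by \<open>p\<close> or \<open>q\<close>.
\<close>

lemma graded_coordinates:
  assumes UFD: "factorial_domain (type_ring :: 'b ring)"
    and nontrivial: "\<not> trivial_pair D U" and invs: "Ker D \<inter> Ker U \<noteq> range i"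
  shows "\<exists>p q e. D p = 0 \<and> wt 0 p \<and> p \<notin> range i
    \<and> (\<forall>f. D f = 0 \<longrightarrow> wt 0 f \<longrightarrow> (\<exists>c g. f = i c + p * g))
    \<and> D q = 0 \<and> wt (int e) q \<and> e > 0 \<and> q \<noteq> 0 \<and> dvd_prime q
    \<and> (\<forall>f n. D f = 0 \<longrightarrow> wt (int n) f \<longrightarrow> n > 0 \<longrightarrow> q dvd f)"
proof -
  obtain w where w: "D w = 0" "wt 0 w" "pt w = 0" "\<not> (d1 w = 0 \<and> d2 w = 0)"
    using invariant_tangent_exists[OF invs] by blast
  obtain x n where x: "D x = 0" "wt (int n) x" "n > 0" "\<not> (d1 x = 0 \<and> d2 x = 0)"
    using positive_tangent_exists[OF nontrivial] by blast
  have ix: "inv_part x = 0" using inv_part_pos x by blast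
  then have ptx: "pt x = 0" using pt_inv_part_eq_0 x by blast
  have iw: "inv_part w = w" using inv_part_id w by blast
  \<comment> \<open>\<open>a\<close> and \<open>b\<close> are the coordinates of the differential of \<open>f\<close> at the point\<close>
  have split: "d1 (inv_part f - i a * w) = 0 \<and> d2 (inv_part f - i a * w) = 0"
    if "D f = 0" "pt f = 0" "d1 f = a * d1 w + b * d1 x" "d2 f = a * d2 w + b * d2 x" for f a b
  proof -
    let ?g = "f - i a * w - i b * x"
    have g: "D ?g = 0" "pt ?g = 0" "d1 ?g = 0" "d2 ?g = 0"
      using that w(1,3) x(1) ptx by (simp_all add: D_simps pt_simps)
    have "inv_part ?g = inv_part f - i a * w"
      using that(1) w(1) x(1) ix iw by (simp add: inv_part_diff inv_part_mult D_simps)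
    then show ?thesis using d_inv_part_eq_0[OF g] by simp
  qed
  \<comment> \<open>a linear relation between the two differentials would be split by the grading\<close>
  have det: "d1 w * d2 x - d2 w * d1 x \<noteq> 0"
  proof
    assume det: "d1 w * d2 x - d2 w * d1 x = 0"
    have tangent: "c * d1 w = 0 \<and> c * d2 w = 0" if "c * d1 w = b * d1 x" "c * d2 w = b * d2 x" for b c
      using split[of "i c * w" 0 b] that w(1,3) iw by (simp add: D_simps pt_simps i_simps inv_part_mult)
    have "d1 x * d1 w = 0 \<and> d1 x * d2 w = 0" "d2 x * d1 w = 0 \<and> d2 x * d2 w = 0"
      using det by (intro tangent[of _ "d1 w"] tangent[of _ "d2 w"]; simp add: mult.commute)+
    then show False using w(4) x(4) by auto
  qed
  have "w \<noteq> 0" "x \<noteq> 0" using w(4) x(4) d_i[of 0] by (auto simp: i_simps)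
  obtain p c where p: "w = p * c" "dvd_prime p" "D p = 0" "D c = 0" "pt p = 0"
    using prime_factor_at_point[OF UFD w(1) \<open>w \<noteq> 0\<close> w(3)] .
  obtain q c' where q: "x = q * c'" "dvd_prime q" "D q = 0" "D c' = 0" "pt q = 0"
    using prime_factor_at_point[OF UFD x(1) \<open>x \<noteq> 0\<close> ptx] .
  have "p \<noteq> 0" "q \<noteq> 0" using p(1) q(1) \<open>w \<noteq> 0\<close> \<open>x \<noteq> 0\<close> by auto
  have "wt 0 p"
    using homogeneous_factor[of p c 0] w(1,2) \<open>w \<noteq> 0\<close> by (auto simp: p(1))
  obtain e e' where e: "n = e + e'" "wt (int e) q" "wt (int e') c'"
    using homogeneous_factor[of q c' n] x(1,2) \<open>x \<noteq> 0\<close> by (auto simp: q(1))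
  \<comment> \<open>if \<open>q\<close> were invariant, then \<open>c'\<close> would also vanish at the point and \<open>x\<close> would be of second order\<close>
  have "e > 0"
  proof (rule ccontr)
    assume "\<not> e > 0"
    then have "pt c' = 0" using e x(3) q(4) inv_part_pos pt_inv_part_eq_0 by auto
    then show False using x(4) q by (simp add: pt_simps)
  qed
  have p_dvd: "p dvd f" if f: "D f = 0" "wt 0 f" "pt f = 0" for f
  proof -
    have reduce: "\<exists>a b. D a = 0 \<and> D b = 0 \<and> pt a = 0 \<and> pt b = 0
        \<and> p dvd f - (inv_part u * a + inv_part v * b)" if f: "D f = 0" "wt 0 f" "pt f = 0" for f
    proof -
      obtain a b where ab: "d1 f = a * d1 w + b * d1 x" "d2 f = a * d2 w + b * d2 x"
        using cramer[OF det, of "d1 f" "d2 f"] by auto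
      let ?g = "f - i a * w"
      have "d1 ?g = 0" "d2 ?g = 0" using split[OF f(1,3) ab] inv_part_id[OF f(1,2)] by simp_all
      moreover have "D ?g = 0" "pt ?g = 0" "wt 0 ?g"
        using f w(1-3) by (simp_all add: D_simps pt_simps wt_diff wt_i_mult)
      ultimately obtain r s where "D r = 0" "D s = 0" "pt r = 0" "pt s = 0"
        and eq: "inv_part ?g = inv_part u * r + inv_part v * s"
        using second_order_inv_part by metis
      moreover have "p dvd f - (inv_part u * r + inv_part v * s)"
        unfolding eq[symmetric] inv_part_id[OF \<open>D ?g = 0\<close> \<open>wt 0 ?g\<close>] by (simp add: p(1))
      ultimately show ?thesis by blast
    qed
    obtain a b where a: "D a = 0" "D b = 0" "pt a = 0" "pt b = 0"
      "p dvd inv_part u - (inv_part u * a + inv_part v * b)"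
      using reduce[of "inv_part u"] by (auto simp: wt_inv_part)
    obtain c d where c: "D c = 0" "D d = 0" "pt c = 0" "pt d = 0"
      "p dvd inv_part v - (inv_part u * c + inv_part v * d)"
      using reduce[of "inv_part v"] by (auto simp: wt_inv_part)
    have uv: "p dvd inv_part u" "p dvd inv_part v"
      using nakayama[OF p(2,3,5) _ _ a(1,2) c(1,2) a(3,4) c(3,4) a(5) c(5)] by simp_all
    obtain a b where "p dvd f - (inv_part u * a + inv_part v * b)" using reduce[OF f] by blast
    then have "p dvd (f - (inv_part u * a + inv_part v * b)) + (inv_part u * a + inv_part v * b)"
      using uv by (intro dvd_add) auto
    then show ?thesis by simp
  qed
  have q_dvd: "q dvd f" if f: "D f = 0" "inv_part f = 0" for f
  proof -
    let ?u = "u - inv_part u" and ?v = "v - inv_part v"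
    have reduce: "\<exists>a b. D a = 0 \<and> D b = 0 \<and> pt a = 0 \<and> pt b = 0 \<and> q dvd f - (?u * a + ?v * b)"
      if f: "D f = 0" "inv_part f = 0" for f
    proof -
      have "pt f = 0" using pt_inv_part_eq_0[OF f] .
      obtain a b where ab: "d1 f = a * d1 w + b * d1 x" "d2 f = a * d2 w + b * d2 x"
        using cramer[OF det, of "d1 f" "d2 f"] by auto
      have "d1 (i a * w) = 0 \<and> d2 (i a * w) = 0"
        using split[OF f(1) \<open>pt f = 0\<close> ab] f(2) w(1) d_diff[of 0 "i a * w"] d_i[of 0]
        by (simp add: D_simps i_simps)
      then have "a = 0" using w by (auto simp: pt_simps D_simps)
      let ?g = "f - i b * x"
      have "D ?g = 0" "inv_part ?g = 0" "d1 ?g = 0" "d2 ?g = 0"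
        using f x(1) ix ab \<open>a = 0\<close> ptx by (simp_all add: D_simps inv_part_diff inv_part_mult pt_simps)
      then obtain r s where "D r = 0" "D s = 0" "pt r = 0" "pt s = 0" and eq: "?g = ?u * r + ?v * s"
        using second_order_positive by metis
      moreover have "q dvd f - (?u * r + ?v * s)" unfolding eq[symmetric] by (simp add: q(1))
      ultimately show ?thesis by blast
    qed
    have uv: "D ?u = 0" "inv_part ?u = 0" "D ?v = 0" "inv_part ?v = 0"
      by (simp_all add: D_simps inv_part_diff inv_part_inv_part)
    obtain a b where a: "D a = 0" "D b = 0" "pt a = 0" "pt b = 0" "q dvd ?u - (?u * a + ?v * b)"
      using reduce[OF uv(1,2)] by blast
    obtain c d where c: "D c = 0" "D d = 0" "pt c = 0" "pt d = 0" "q dvd ?v - (?u * c + ?v * d)"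
      using reduce[OF uv(3,4)] by blast
    have dvd: "q dvd ?u" "q dvd ?v"
      using nakayama[OF q(2,3,5) uv(1,3) a(1,2) c(1,2) a(3,4) c(3,4) a(5) c(5)] by simp_all
    obtain a b where "f - inv_part f = ?u * a + ?v * b" using expand_positive[OF f(1)] by blast
    then show ?thesis using dvd f(2) by simp
  qed
  have "p \<notin> range i" using p(5) \<open>p \<noteq> 0\<close> by (auto simp: i_simps)
  moreover have "\<exists>c g. f = i c + p * g" if f: "D f = 0" "wt 0 f" for f
  proof -
    have "p dvd f - i (pt f)"
      using f by (intro p_dvd) (simp_all add: D_simps wt_diff pt_simps)
    then obtain g where "f - i (pt f) = p * g" by (auto simp: dvd_def)
    then have "f = i (pt f) + p * g" by (simp add: algebra_simps)
    then show ?thesis by blast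
  qed
  moreover have "q dvd f" if "D f = 0" "wt (int m) f" "m > 0" for f m
    using q_dvd inv_part_pos that by blast
  ultimately show ?thesis
    using p(3) \<open>wt 0 p\<close> q(2,3) e(2) \<open>e > 0\<close> \<open>q \<noteq> 0\<close> by blast
qed

end

section \<open>Derivations on finitely generated algebras\<close>

lemma hom_map_poly:
  assumes "is_hom j"
  shows "poly (map_poly j (pCons c P)) x = j c + x * poly (map_poly j P) x"
    "poly (map_poly j 0) x = 0"
    "poly (map_poly j (P + Q)) x = poly (map_poly j P) x + poly (map_poly j Q) x"
    "poly (map_poly j (smult c P)) x = j c * poly (map_poly j P) x"
proof -
  note j = is_hom_simps[OF assms]
  show step: "poly (map_poly j (pCons c P)) x = j c + x * poly (map_poly j P) x" for c P
    by (simp add: map_poly_pCons j)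
  show "poly (map_poly j 0) x = 0" by simp
  show "poly (map_poly j (P + Q)) x = poly (map_poly j P) x + poly (map_poly j Q) x"
    by (induction P Q rule: poly_induct2) (simp_all add: step j algebra_simps)
  show "poly (map_poly j (smult c P)) x = j c * poly (map_poly j P) x"
    by (induction P) (simp_all add: step j algebra_simps)
qed

lemma mpol_eval_poly:
  assumes "is_hom j"
  shows "mpol_eval j x (poly (map_poly Const Q) r) = poly (map_poly j Q) (mpol_eval j x r)"
  by (induction Q)
    (simp_all add: hom_map_poly[OF Const_hom] hom_map_poly[OF assms]
      is_hom_simps[OF mpol_eval_hom[OF assms]] mpol_eval_Const[OF assms])

lemma derivation_poly:
  assumes E: "derivation E" and j: "is_hom j" and "\<And>c. E (j c) = 0"
  shows "E (poly (map_poly j P) x) = poly (map_poly j (pderiv P)) x * E x"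
proof (induction P)
  case 0
  then show ?case by (simp add: derivation_simps[OF E])
next
  case (pCons c P)
  then show ?case
    by (simp add: hom_map_poly[OF j] derivation_simps[OF E] assms(3) pderiv_pCons is_hom_simps(2)[OF j] algebra_simps)
qed

text \<open>
  A vector field on the source of a surjective homomorphism descends to the target if it
  preserves the kernel.
\<close>

lemma induced_derivation:
  assumes ev: "is_hom ev" "surj ev" and E: "derivation E" and ker: "\<And>r. ev r = 0 \<Longrightarrow> ev (E r) = 0"
  obtains F where "derivation F" "\<And>r. F (ev r) = ev (E r)"
proof -
  define F where "F b = ev (E (SOME r. ev r = b))" for b
  have F: "F (ev r) = ev (E r)" for r
  proof -
    let ?s = "SOME s. ev s = ev r"
    have "ev ?s = ev r" by (rule someI) (rule refl)
    then have "ev (E (?s - r)) = 0" by (intro ker) (simp add: is_hom_simps[OF ev(1)])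
    then show ?thesis by (simp add: F_def derivation_simps[OF E] is_hom_simps[OF ev(1)])
  qed
  have "F (a + b) = F a + F b \<and> F (a * b) = a * F b + F a * b" for a b
  proof -
    obtain r s where rs: "a = ev r" "b = ev s" using ev(2) by (metis surj_def)
    have "F (ev (r + s)) = F (ev r) + F (ev s)" "F (ev (r * s)) = ev r * F (ev s) + F (ev r) * ev s"
      unfolding F by (simp_all add: derivation_simps[OF E] is_hom_simps[OF ev(1)])
    then show ?thesis by (simp add: rs is_hom_simps[OF ev(1)])
  qed
  then have "derivation F" by (simp add: derivation_def)
  then show ?thesis using that F by blast
qed

text \<open>
  The elements that are killed by a power of \<open>F\<close> form a subalgebra, so it suffices to test
  local nilpotency on generators.
\<close>

lemma locally_nilpotent_generators:
  fixes F :: "'b::comm_ring_1 \<Rightarrow> 'b" and j :: "'k::field \<Rightarrow> 'b" and x :: "'n::finite \<Rightarrow> 'b"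
  assumes F: "derivation F" and j: "is_hom j" "\<And>c. F (j c) = 0"
    and gen: "\<And>v. \<exists>n. (F ^^ n) (x v) = 0"
  shows "\<exists>n. (F ^^ n) (mpol_eval j x r) = 0"
proof (induction r rule: mpol_induct)
  case (const c)
  show ?case by (intro exI[of _ 1]) (simp add: mpol_eval_Const j)
next
  case (add r s)
  then obtain m n where "(F ^^ m) (mpol_eval j x r) = 0" "(F ^^ n) (mpol_eval j x s) = 0" by blast
  then have "(F ^^ (n + m)) (mpol_eval j x r) = 0" "(F ^^ (m + n)) (mpol_eval j x s) = 0"
    by (simp_all add: funpow_add derivation_simps[OF F])
  then show ?case
    by (intro exI[of _ "m + n"]) (simp add: mpol_eval_add j derivation_simps[OF F] add.commute)
next
  case (var v r)
  then show ?case using gen[of v] locally_nilpotent_mult[OF F] by (metis mpol_eval_Var_mult j(1))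
qed

section \<open>The weight of the second coordinate\<close>

text \<open>
  The outcome of the analysis of \<open>ker D\<close>: it is \<open>k[p, q]\<close>, graded with \<open>p\<close> of weight 0 and \<open>q\<close> of weight
  \<open>e > 0\<close>.
\<close>

locale graded_plane = sl2_pair i D U for i :: "'k::field_char_0 \<Rightarrow> 'b::idom" and D U +
  fixes p q :: 'b and e :: nat
  assumes D_p [simp]: "D p = 0" and wt_p: "wt 0 p"
    and transcendental_p: "\<And>c. poly (map_poly i c) p = 0 \<Longrightarrow> c = 0"
    and invariant_poly: "\<And>f. D f = 0 \<Longrightarrow> wt 0 f \<Longrightarrow> \<exists>P. f = poly (map_poly i P) p"
    and D_q [simp]: "D q = 0" and wt_q: "wt (int e) q" and e_pos: "e > 0"
    and q_nonzero: "q \<noteq> 0" and q_prime: "dvd_prime q"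
    and q_dvd: "\<And>f n. D f = 0 \<Longrightarrow> wt (int n) f \<Longrightarrow> n > 0 \<Longrightarrow> q dvd f"
begin

lemma U_p [simp]: "U p = 0"
  using invariants[of p] wt_p by simp

lemma D_Uq: "D (U q) = of_nat e * q"
  using wt_q by (simp add: DU wt_def U_simps)

text \<open>
  A quotient \<open>t = U q / q\<close> would have weight \<open>-2\<close> and \<open>D t = e\<close>; but \<open>U e = 0\<close>, so
  \<open>negative_weight_eq_0\<close> gives \<open>t = 0\<close>.
\<close>

lemma not_q_dvd_Uq: "\<not> q dvd U q"
proof
  assume "q dvd U q"
  then obtain t where t: "U q = q * t" by (auto simp: dvd_def)
  have "q * D t = q * of_nat e" using D_Uq by (simp add: t D_simps mult.commute)
  then have Dt: "D t = of_nat e" using q_nonzero by simp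
  have "wt (int e - 2) (q * t)" using wt_U[OF wt_q] by (simp add: t)
  then have "wt (- 2) t" using wt_mult_cancel[OF _ wt_q q_nonzero] by fastforce
  then have "t = 0" using negative_weight_eq_0[of "- 2" t] Dt by (simp add: U_simps)
  then show False using Dt e_pos of_nat_eq_0_iff'[of e] by (simp add: D_simps)
qed

text \<open>
  Up to a factor, \<open>a\<close> is the leading coefficient of the Hessian of the binary form of degree \<open>e\<close> whose
  highest weight vector is \<open>q\<close>; hence \<open>D a = 0\<close>.  Its weight \<open>2 e - 4\<close> is positive if \<open>e \<ge> 3\<close>.
\<close>

lemma e_le_2: "e \<le> 2"
proof (rule ccontr)
  assume "\<not> e \<le> 2"
  then obtain n where n: "e = n + 3"
    by (metis add.commute le_add_diff_inverse not_less_eq_eq numeral_2_eq_2 numeral_3_eq_3)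
  define y z where "y = U q" and "z = U y"
  have Dy: "D y = of_nat (n + 3) * q" using D_Uq by (simp add: y_def n)
  have wy: "wt (int n + 1) y" using wt_U[OF wt_q] by (simp add: y_def n add.commute)
  have "D z = U (D y) + H y" by (simp add: z_def DU)
  also have "U (D y) = of_nat (n + 3) * y"
    by (simp only: Dy derivation_mult_const(1)[OF U_der U_simps(7)] y_def[symmetric])
  also have "H y = of_nat (n + 1) * y" using wy by (simp add: wt_def)
  finally have Dz: "D z = of_nat (2 * n + 4) * y" by (simp add: algebra_simps)
  \<comment> \<open>here \<open>e = n + 3\<close>\<close>
  define a where "a = of_nat (n + 2) * y ^ 2 - of_nat (n + 3) * (q * z)"
  have "D a = of_nat (n + 2) * (2 * y * D y) - of_nat (n + 3) * (q * D z)"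
    by (simp add: a_def D_simps power2_eq_square algebra_simps)
  also have "\<dots> = 0" unfolding Dy Dz by (simp add: algebra_simps)
  finally have Da: "D a = 0" .
  have "wt (int n + 1 + (int n + 1)) (y ^ 2)" unfolding power2_eq_square by (rule wt_mult[OF wy wy])
  moreover have "wt (int e + (int n + 1 - 2)) (q * z)" unfolding z_def by (rule wt_mult[OF wt_q wt_U[OF wy]])
  ultimately have "wt (int (2 * n + 2)) a"
    unfolding a_def n by (intro wt_diff wt_of_int_mult[of _ _ "int _", simplified]) (simp_all add: algebra_simps)
  from q_dvd[OF Da this] have "q dvd a + of_nat (n + 3) * (q * z)" by simp
  then have "q dvd of_nat (n + 2) * y ^ 2" by (simp add: a_def)
  then have "q dvd i (inverse (of_nat (n + 2))) * (of_nat (n + 2) * y ^ 2)" by (rule dvd_mult)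
  moreover have "i (inverse (of_nat (n + 2))) * of_nat (n + 2) = i (inverse (of_nat (n + 2)) * of_nat (n + 2))"
    by (simp only: i_simps)
  moreover have "inverse (of_nat (n + 2)) * of_nat (n + 2) = (1::'k)"
    by (rule left_inverse) (metis of_nat_eq_0_iff add_2_eq_Suc' nat.distinct(1))
  ultimately have "q dvd y ^ 2" by (simp only: mult.assoc[symmetric] i_simps mult_1_left)
  then have "q dvd y" using q_prime by (auto simp: dvd_prime_def power2_eq_square)
  then show False using not_q_dvd_Uq by (simp add: y_def)
qed

lemma Ker_D_generated:
  assumes add: "\<And>a b. a \<in> S \<Longrightarrow> b \<in> S \<Longrightarrow> a + b \<in> S"
    and mult: "\<And>a b. a \<in> S \<Longrightarrow> b \<in> S \<Longrightarrow> a * b \<in> S"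
    and const: "\<And>c. i c \<in> S" and pq: "p \<in> S" "q \<in> S"
    and "D a = 0" "wt (int n) a"
  shows "a \<in> S"
  using assms(6,7)
proof (induction n arbitrary: a rule: less_induct)
  case (less n)
  show ?case
  proof (cases "n = 0")
    case True
    then obtain P where P: "a = poly (map_poly i P) p" using invariant_poly less.prems by auto
    have "poly (map_poly i P) p \<in> S"
      by (induction P) (use const[of 0] in \<open>simp_all add: hom_map_poly[OF i_hom] i_simps add mult const pq\<close>)
    then show ?thesis by (simp add: P)
  next
    case False
    then obtain g where g: "a = q * g" using q_dvd less.prems by (auto simp: dvd_def)
    have Dg: "D g = 0" using Ker_D_mult_cancel[of q g] less.prems(1) q_nonzero by (simp add: g)
    have wg: "wt (int n - int e) g" using wt_mult_cancel[OF _ wt_q q_nonzero] less.prems(2) by (simp add: g)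
    have "g \<in> S"
    proof (cases "e \<le> n")
      case True
      then show ?thesis using less.IH[of "n - e" g] Dg wg e_pos False by (simp add: of_nat_diff)
    next
      case False
      then have "g = 0" using Ker_D_weight_nonneg[OF wg Dg] by simp
      then show ?thesis using const[of 0] by (simp add: i_simps)
    qed
    then show ?thesis unfolding g by (intro mult pq)
  qed
qed

definition D_degree :: "nat \<Rightarrow> 'b \<Rightarrow> bool" where
  "D_degree n b \<longleftrightarrow> (D ^^ n) b \<noteq> 0 \<and> (D ^^ Suc n) b = 0"

lemma D_degree_mult:
  assumes "D_degree m a" "D_degree n b"
  shows "D_degree (m + n) (a * b)"
proof -
  have a: "(D ^^ m) a \<noteq> 0" "(D ^^ Suc m) a = 0" and b: "(D ^^ n) b \<noteq> 0" "(D ^^ Suc n) b = 0"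
    using assms unfolding D_degree_def by blast+
  have "(of_nat ((m + n) choose m) :: 'b) \<noteq> 0" by (simp add: of_nat_eq_0_iff')
  then show ?thesis
    unfolding D_degree_def conjunct1[OF leibniz_top[OF D_der a(2) b(2)]]
    using a(1) b(1) conjunct2[OF leibniz_top[OF D_der a(2) b(2)]] by (simp del: funpow.simps)
qed

lemma D_degree_power: "D_degree m a \<Longrightarrow> D_degree (n * m) (a ^ n)"
proof (induction n)
  case 0
  then show ?case by (simp add: D_degree_def D_simps)
next
  case (Suc n)
  then show ?case using D_degree_mult[of m a "n * m" "a ^ n"] by simp
qed

text \<open>
  Three degrees separate the monomials: the nilpotency degree with respect to \<open>D\<close> determines the
  index \<open>J\<close>, the weight determines the exponent of \<open>q\<close>, and \<open>p\<close> is transcendental over \<open>k\<close>.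
\<close>

lemma monomials_independent:
  assumes "finite M" "inj_on (\<lambda>m. (A m, C m, J m)) M" and b: "\<And>j. D_degree j (b j)"
    and sum: "(\<Sum>m\<in>M. i (k m) * (p ^ A m * q ^ C m * b (J m))) = 0" and "m \<in> M"
  shows "k m = 0"
proof -
  define S1 where "S1 j = {m \<in> M. J m = j}" for j
  define S2 where "S2 j c = {m \<in> S1 j. C m = c}" for j c
  have fin: "finite (S1 j)" "finite (S2 j c)" for j c using assms(1) by (auto simp: S1_def S2_def)
  have DpA: "D (p ^ a) = 0" for a by (induction a) (auto simp: D_simps)
  have DqC: "D (q ^ c) = 0" for c by (induction c) (auto simp: D_simps)
  have "(\<Sum>j\<in>J ` M. (\<Sum>m\<in>S1 j. i (k m) * (p ^ A m * q ^ C m)) * b j)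
      = (\<Sum>j\<in>J ` M. \<Sum>m\<in>S1 j. i (k m) * (p ^ A m * q ^ C m * b (J m)))"
    by (intro sum.cong refl) (auto simp: sum_distrib_right S1_def mult.assoc)
  also have "\<dots> = 0" unfolding S1_def sum[symmetric] using assms(1) by (intro sum.group) auto
  finally have zero1: "(\<Sum>j\<in>J ` M. (\<Sum>m\<in>S1 j. i (k m) * (p ^ A m * q ^ C m)) * b j) = 0" .
  have "(\<Sum>m\<in>S1 (J m). i (k m) * (p ^ A m * q ^ C m)) = 0"
  proof (rule independent_over_kernel[OF D_der _ _ _ _ zero1])
    show "D (\<Sum>m\<in>S1 j. i (k m) * (p ^ A m * q ^ C m)) = 0" for j
      unfolding D_simps(10) by (rule sum.neutral) (simp add: D_simps DpA DqC)
  qed (use b assms(1,5) in \<open>auto simp: D_degree_def\<close>)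
  also have "(\<Sum>m\<in>S1 (J m). i (k m) * (p ^ A m * q ^ C m))
      = (\<Sum>c\<in>C ` S1 (J m). \<Sum>m\<in>S2 (J m) c. i (k m) * (p ^ A m * q ^ C m))"
    unfolding S2_def using fin by (intro sum.group[symmetric]) auto
  also have "\<dots> = (\<Sum>c\<in>C ` S1 (J m). (\<Sum>m\<in>S2 (J m) c. i (k m) * p ^ A m) * q ^ c)"
    by (intro sum.cong refl) (auto simp: sum_distrib_right S2_def mult.assoc)
  finally have zero2: "(\<Sum>c\<in>C ` S1 (J m). (\<Sum>m\<in>S2 (J m) c. i (k m) * p ^ A m) * q ^ c) = 0" .
  have "\<forall>c\<in>C ` S1 (J m). (\<Sum>m\<in>S2 (J m) c. i (k m) * p ^ A m) * q ^ c = 0"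
  proof (rule wt_unique_weights[where g = "\<lambda>c. 0 + int c * int e"])
    show "inj_on (\<lambda>c. 0 + int c * int e) (C ` S1 (J m))" using e_pos by (auto simp: inj_on_def)
    show "wt (0 + int c * int e) ((\<Sum>m\<in>S2 (J m) c. i (k m) * p ^ A m) * q ^ c)" for c
    proof (intro wt_mult wt_sum wt_i_mult wt_power wt_q)
      show "wt 0 (p ^ a)" for a using wt_power[OF wt_p, of a] by simp
    qed
  qed (use fin zero2 in auto)
  then have zero3: "(\<Sum>m\<in>S2 (J m) (C m). i (k m) * p ^ A m) = 0"
    using assms(5) q_nonzero by (auto simp: S1_def)
  define P where "P = (\<Sum>m\<in>S2 (J m) (C m). monom (k m) (A m))"
  have monom: "poly (map_poly i (monom c a)) p = i c * p ^ a" for c a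
    by (simp add: map_poly_monom i_simps poly_monom)
  have "poly (map_poly i (\<Sum>m\<in>T. monom (k m) (A m))) p = (\<Sum>m\<in>T. i (k m) * p ^ A m)" for T
    by (induction T rule: infinite_finite_induct) (simp_all add: hom_map_poly[OF i_hom] monom)
  then have "P = 0" using zero3 transcendental_p by (simp add: P_def)
  have "coeff P (A m) = (\<Sum>m'\<in>S2 (J m) (C m). if m' = m then k m else 0)"
    unfolding P_def coeff_sum
  proof (intro sum.cong refl)
    fix m' assume m': "m' \<in> S2 (J m) (C m)"
    then have "A m' = A m \<Longrightarrow> m' = m"
      using inj_onD[OF assms(2), of m' m] assms(5) by (auto simp: S2_def S1_def)
    then show "coeff (monom (k m') (A m')) (A m) = (if m' = m then k m else 0)" by auto
  qed
  also have "\<dots> = k m" using fin assms(5) by (simp add: S2_def S1_def)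
  finally show ?thesis using \<open>P = 0\<close> by simp
qed

text \<open>
  A common kernel element is an invariant \<open>P(p)\<close>, and \<open>0 = F (P(p)) = P'(p) F p\<close> forces \<open>P' = 0\<close>.
\<close>

lemma makar_limanov_eq:
  assumes "F \<in> LND" "F p \<noteq> 0"
  shows "makar_limanov = range i"
proof
  show "range i \<subseteq> makar_limanov"
    using LND_i by (auto simp: makar_limanov_def Ker_def)
  show "makar_limanov \<subseteq> range i"
  proof
    fix f :: 'b assume "f \<in> makar_limanov"
    then have "D f = 0" "U f = 0" "F f = 0"
      using D_LND U_LND assms(1) by (auto simp: makar_limanov_def Ker_def)
    then obtain P where P: "f = poly (map_poly i P) p" using invariants invariant_poly by blast
    have "derivation F" using assms(1) by (simp add: LND_def)
    then have "poly (map_poly i (pderiv P)) p * F p = 0"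
      using derivation_poly[of F i P p] i_hom LND_i[OF assms(1)] \<open>F f = 0\<close> by (simp add: P)
    then have "pderiv P = 0" using assms(2) transcendental_p by simp
    then have "degree P = 0" by (simp add: pderiv_eq_0_iff)
    then obtain c where "P = [:c:]" by (rule degree_eq_zeroE)
    then show "f \<in> range i" by (simp add: P map_poly_pCons i_simps)
  qed
qed

end

context sl2_plane
begin

text \<open>
  Every invariant is \<open>c + p g\<close> with an invariant \<open>g\<close> of smaller total degree, so that invariants are
  polynomials in \<open>p\<close>.
\<close>

lemma graded_plane_exists:
  assumes UFD: "factorial_domain (type_ring :: 'b ring)"
    and nontrivial: "\<not> trivial_pair D U" and invs: "Ker D \<inter> Ker U \<noteq> range i"
  shows "\<exists>p q e. graded_plane i D U p q e"
proof -
  obtain u v pt d1 d2 where "pointed_plane i D U h u v pt d1 d2" using pointed_plane_exists by blast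
  then interpret pointed_plane i D U h u v pt d1 d2 .
  obtain p q e where p: "D p = 0" "wt 0 p" "p \<notin> range i"
    and inv: "\<And>f. D f = 0 \<Longrightarrow> wt 0 f \<Longrightarrow> \<exists>c g. f = i c + p * g"
    and q: "D q = 0" "wt (int e) q" "e > 0" "q \<noteq> 0" "dvd_prime q"
      "\<And>f n. D f = 0 \<Longrightarrow> wt (int n) f \<Longrightarrow> n > 0 \<Longrightarrow> q dvd f"
    using graded_coordinates[OF UFD nontrivial invs] by blast
  obtain deg :: "'b \<Rightarrow> nat" where deg:
    "\<And>c p g. D p = 0 \<Longrightarrow> D g = 0 \<Longrightarrow> g \<noteq> 0 \<Longrightarrow> p \<notin> range i \<Longrightarrow> deg g < deg (i c + p * g)"
    by (rule degree_descent) blast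
  have "p \<noteq> 0" using p(3) by (metis i_simps(2) rangeI)
  have "\<exists>P. f = poly (map_poly i P) p" if "D f = 0" "wt 0 f" for f
    using that
  proof (induction "deg f" arbitrary: f rule: less_induct)
    case less
    obtain c g where f: "f = i c + p * g" using inv less.prems by blast
    show ?case
    proof (cases "g = 0")
      case True
      then show ?thesis by (intro exI[of _ "[:c:]"]) (simp add: f map_poly_pCons i_simps)
    next
      case False
      have "D (p * g) = 0" using less.prems(1) by (simp add: f D_simps)
      then have Dg: "D g = 0" using Ker_D_mult_cancel p(1) \<open>p \<noteq> 0\<close> by blast
      have "wt 0 (f - i c)" using less.prems(2) by (intro wt_diff) auto
      then have "wt 0 (p * g)" by (simp add: f)
      then have wg: "wt 0 g" using wt_mult_cancel[OF _ p(2) \<open>p \<noteq> 0\<close>, of 0 g] by simp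
      have "deg g < deg f" unfolding f by (rule deg[OF p(1) Dg False p(3)])
      then obtain P where "g = poly (map_poly i P) p" using less.hyps Dg wg by blast
      then show ?thesis by (intro exI[of _ "pCons c P"]) (simp add: f hom_map_poly[OF i_hom])
    qed
  qed
  then have "graded_plane i D U p q e"
    using p q transcendental[OF p(1,3)] by unfold_locales auto
  then show ?thesis by blast
qed

end

section \<open>The two models\<close>

lemma ring_iso_type_ring:
  "f \<in> ring_iso type_ring type_ring \<longleftrightarrow> is_hom f \<and> bij f"
  by (auto simp: ring_iso_def is_hom_type_ring) (simp_all add: ring_of_type_algebra_def)

lemma transport_type_ring:
  assumes "surj f" "\<And>r. f (F r) = G (f r)"
  shows "transport type_ring f F = G"
proof
  fix b
  have "f (inv_into UNIV f b) = b" using assms(1) by (simp add: surj_f_inv_f)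
  then show "transport type_ring f F b = G b"
    by (simp add: transport_def assms(2)) (simp add: ring_of_type_algebra_def)
qed

context graded_plane
begin

definition point3 :: "3 \<Rightarrow> 'b" where
  "point3 v = (if v = 0 then p else if v = 1 then q else U q)"

abbreviation ev3 :: "(3, 'k) mpol \<Rightarrow> 'b" where
  "ev3 \<equiv> mpol_eval i point3"

lemmas ev3_hom = mpol_eval_hom[OF i_hom, of point3]

lemma point3_simps: "point3 0 = p" "point3 1 = q" "point3 2 = U q"
  using distinct_3 by (simp_all add: point3_def)

text \<open>
  The image of the evaluation is a subalgebra that contains \<open>ker D = k[p, q]\<close>.
\<close>

lemma surj_mpol_eval:
  fixes x :: "'n::finite \<Rightarrow> 'b"
  assumes U_ev: "\<And>r. \<exists>s. U (mpol_eval i x r) = mpol_eval i x s"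
    and "x v = p" "x w = q"
  shows "surj (mpol_eval i x)"
proof -
  have add: "a + b \<in> range (mpol_eval i x)" and mult: "a * b \<in> range (mpol_eval i x)"
    if ab: "a \<in> range (mpol_eval i x)" "b \<in> range (mpol_eval i x)" for a b
  proof -
    obtain r s where rs: "a = mpol_eval i x r" "b = mpol_eval i x s" using ab by blast
    have "a + b = mpol_eval i x (r + s)" "a * b = mpol_eval i x (r * s)"
      unfolding rs by (simp_all add: is_hom_simps(3,4)[OF mpol_eval_hom[OF i_hom]])
    then show "a + b \<in> range (mpol_eval i x)" "a * b \<in> range (mpol_eval i x)" by simp_all
  qed
  have const: "i c \<in> range (mpol_eval i x)" for c
    using mpol_eval_Const[OF i_hom, of x c] by (metis rangeI)
  have gens: "p \<in> range (mpol_eval i x)" "q \<in> range (mpol_eval i x)"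
    using mpol_eval_Var[OF i_hom] assms(2,3) by (metis rangeI)+
  have "b \<in> range (mpol_eval i x)" for b
  proof (rule U_stable_span_of_kernel[where S = "range (mpol_eval i x)"])
    fix a assume a: "a \<in> range (mpol_eval i x)"
    show "i c * a \<in> range (mpol_eval i x)" for c by (rule mult[OF const a])
    obtain r where "a = mpol_eval i x r" using a by blast
    then show "U a \<in> range (mpol_eval i x)" using U_ev[of r] by auto
    show "a + b \<in> range (mpol_eval i x)" if "b \<in> range (mpol_eval i x)" for b by (rule add[OF a that])
  next
    fix a n assume a: "D a = 0" "wt (int n) a"
    show "a \<in> range (mpol_eval i x)"
      by (rule Ker_D_generated[where S = "range (mpol_eval i x)", OF _ _ const gens a]) (fact add, fact mult)
  qed
  then show ?thesis by (rule UNIV_eq_I[symmetric])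
qed

lemma U_Uq_0: "e = 1 \<Longrightarrow> U (U q) = 0"
  using U_pow_eq_0[OF wt_q] by simp

lemma D_ev3:
  assumes "e = 1"
  shows "ev3 (D3 r) = D (ev3 r)"
  using D_Uq assms
  by (simp add: derivation_mpol_eval[OF D_der i_hom] sum_3 point3_simps D3_def
      is_hom_simps[OF ev3_hom] mpol_eval_Var[OF i_hom])

lemma U_ev3:
  assumes "e = 1"
  shows "ev3 (U3 r) = U (ev3 r)"
  using U_Uq_0[OF assms]
  by (simp add: derivation_mpol_eval[OF U_der i_hom] sum_3 point3_simps U3_def
      is_hom_simps[OF ev3_hom] mpol_eval_Var[OF i_hom])

lemma inj_ev3:
  assumes "e = 1" "ev3 r = 0"
  shows "r = 0"
proof -
  have "D_degree 1 (U q)" using D_Uq q_nonzero assms(1) by (simp add: D_degree_def)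
  then have deg: "D_degree j (U q ^ j)" for j using D_degree_power[of 1 "U q" j] by simp
  let ?l = Poly_Mapping.lookup
  have "?l r m = 0" if "m \<in> Poly_Mapping.keys r" for m
  proof (rule monomials_independent[OF _ _ deg _ that])
    show "inj_on (\<lambda>m. (?l m 0, ?l m 1, ?l m 2)) (Poly_Mapping.keys r)"
    proof (rule inj_onI, rule poly_mapping_eqI)
      fix m m' :: "3 \<Rightarrow>\<^sub>0 nat" and v :: 3
      assume "(?l m 0, ?l m 1, ?l m 2) = (?l m' 0, ?l m' 1, ?l m' 2)"
      moreover have "v \<in> {0, 1, 2}" using UNIV_I[of v] unfolding UNIV_3 .
      ultimately show "?l m v = ?l m' v" by auto
    qed
    show "(\<Sum>m\<in>Poly_Mapping.keys r. i (?l r m) * (p ^ ?l m 0 * q ^ ?l m 1 * U q ^ ?l m 2)) = 0"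
      using assms(2) by (simp add: mpol_eval_def monomial_value_def prod_3 point3_simps)
  qed auto
  then show ?thesis
    by (intro poly_mapping_eqI) (metis lookup_zero in_keys_iff)
qed

text \<open>
  The Makar-Limanov invariant is cut down by the derivation \<open>\<partial>/\<partial>p\<close>.
\<close>

lemma model3:
  assumes "e = 1"
  shows "ev3 \<in> alg_iso type_ring Const type_ring i"
    "transport type_ring ev3 D3 = D" "transport type_ring ev3 U3 = U"
    "(makar_limanov :: 'b set) = range i"
proof -
  have surj: "surj ev3"
    by (rule surj_mpol_eval[of _ 0 1]) (use U_ev3[OF assms] point3_simps in \<open>metis, simp_all\<close>)
  moreover have "inj ev3"
  proof (rule injI)
    fix r s assume "ev3 r = ev3 s"
    then have "r - s = 0" by (intro inj_ev3[OF assms]) (simp add: is_hom_simps[OF ev3_hom])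
    then show "r = s" by simp
  qed
  ultimately have "bij ev3" by (simp add: bij_def)
  then show "ev3 \<in> alg_iso type_ring Const type_ring i"
    by (simp add: alg_iso_def ring_iso_type_ring ev3_hom mpol_eval_Const[OF i_hom])
  show "transport type_ring ev3 D3 = D" "transport type_ring ev3 U3 = U"
    using transport_type_ring[OF surj] D_ev3 U_ev3 assms by blast+
  obtain F where F: "derivation F" "\<And>r. F (ev3 r) = ev3 (partial 0 r)"
  proof (rule induced_derivation[OF ev3_hom surj partial_derivation])
    show "ev3 (partial 0 r) = 0" if "ev3 r = 0" for r
      using inj_ev3[OF assms that] by (simp add: derivation_simps[OF partial_derivation] is_hom_simps[OF ev3_hom])
  qed blast
  have Fi: "F (i c) = 0" for c
    using F(2)[of "Const c"] by (simp add: mpol_eval_Const[OF i_hom] partial_Const is_hom_simps[OF ev3_hom])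
  have F_point: "F (point3 v) = (if v = 0 then 1 else 0)" for v
    using F(2)[of "Var v"] by (simp add: mpol_eval_Var[OF i_hom] partial_Var is_hom_simps[OF ev3_hom])
  have "\<exists>n. (F ^^ n) b = 0" for b
  proof -
    obtain r where "b = ev3 r" using surj by (metis surj_def)
    moreover have "\<exists>n. (F ^^ n) (point3 v) = 0" for v
      by (intro exI[of _ 2]) (simp add: numeral_2_eq_2 F_point derivation_simps[OF F(1)])
    ultimately show ?thesis using locally_nilpotent_generators[OF F(1) i_hom Fi] by blast
  qed
  then have "F \<in> LND" using F(1) by (simp add: LND_def)
  moreover have "F p \<noteq> 0" using F_point[of 0] by (simp add: point3_simps)
  ultimately show "(makar_limanov :: 'b set) = range i" by (rule makar_limanov_eq)
qed

definition half :: 'b where "half = i (1 / 2)"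

lemma two_half: "2 * half = 1"
proof -
  have "2 * half = i (2 * (1 / 2))" by (simp only: half_def i_simps)
  then show ?thesis by (simp add: i_simps)
qed

lemma two_half_mult [simp]: "2 * (half * b) = b"
  using two_half by (simp flip: mult.assoc)

lemma D_half [simp]: "D (half * b) = half * D b" and U_half [simp]: "U (half * b) = half * U b"
  by (simp_all add: half_def D_simps U_simps)

text \<open>
  In the second model \<open>X\<close>, \<open>Y\<close>, \<open>Z\<close>, \<open>W\<close> are \<open>q\<close>, \<open>y4\<close>, \<open>z4\<close>, \<open>p\<close>.  The factors \<open>1/2\<close> are forced by
  \<open>U X = 2 Y\<close> and \<open>U Y = 2 Z\<close>.
\<close>

definition y4 :: 'b where "y4 = half * U q"
definition z4 :: 'b where "z4 = half * U y4"

definition point4 :: "4 \<Rightarrow> 'b" where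
  "point4 v = (if v = 0 then q else if v = 1 then y4 else if v = 2 then z4 else p)"

abbreviation ev4 :: "(4, 'k) mpol \<Rightarrow> 'b" where
  "ev4 \<equiv> mpol_eval i point4"

lemmas ev4_hom = mpol_eval_hom[OF i_hom, of point4]
lemmas ev4_simps = is_hom_simps[OF ev4_hom] mpol_eval_Var[OF i_hom] mpol_eval_Const[OF i_hom]

lemma point4_simps: "point4 0 = q" "point4 1 = y4" "point4 2 = z4" "point4 3 = p"
  using distinct_4 by (simp_all add: point4_def)

lemma U_4: "U q = 2 * y4" "U y4 = 2 * z4"
  by (simp_all add: y4_def z4_def)

lemma D_y4:
  assumes "e = 2"
  shows "D y4 = q"
proof -
  have "half * (2 * q) = q" using two_half_mult[of q] by (simp only: mult.left_commute)
  then show ?thesis using D_Uq assms by (simp add: y4_def)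
qed

lemma wt_y4: "e = 2 \<Longrightarrow> wt 0 y4"
  unfolding y4_def half_def using wt_U[OF wt_q] by (intro wt_i_mult) simp

lemma wt_z4: "e = 2 \<Longrightarrow> wt (- 2) z4"
  unfolding z4_def half_def using wt_U[OF wt_y4] by (intro wt_i_mult) simp

lemma D_z4:
  assumes "e = 2"
  shows "D z4 = y4"
proof -
  have "D (U y4) = U q" using DU[of y4] wt_y4[OF assms] D_y4[OF assms] by (simp add: wt_def)
  then show ?thesis by (simp add: z4_def y4_def)
qed

lemma U_z4:
  assumes "e = 2"
  shows "U z4 = 0"
proof -
  have "(U ^^ Suc 2) q = 0" using U_pow_eq_0[OF wt_q] assms by simp
  then have "U (U (U q)) = 0" by (simp add: numeral_2_eq_2)
  then show ?thesis by (simp add: z4_def y4_def)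
qed

lemma D_ev4:
  assumes "e = 2"
  shows "ev4 (D4 r) = D (ev4 r)"
  by (simp add: derivation_mpol_eval[OF D_der i_hom] sum_4 point4_simps D4_def
      ev4_simps D_y4[OF assms] D_z4[OF assms])

lemma U_ev4:
  assumes "e = 2"
  shows "ev4 (U4 r) = U (ev4 r)"
  by (simp add: derivation_mpol_eval[OF U_der i_hom] sum_4 point4_simps U4_def
      ev4_simps U_4 U_z4[OF assms])

lemma surj_ev4:
  assumes "e = 2"
  shows "surj ev4"
  by (rule surj_mpol_eval[of _ 3 0]) (use U_ev4[OF assms] point4_simps in \<open>metis, simp_all\<close>)

definition relation :: "'k poly \<Rightarrow> (4, 'k) mpol" where
  "relation P = 2 * Var 0 * Var 2 - Var 1 ^ 2 - poly (map_poly Const P) (Var 3)"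

text \<open>
  \<open>2 q z - y\<^sup>2\<close> is killed by \<open>D\<close> and has weight 0, so it is a polynomial in \<open>p\<close>.
\<close>

lemma relation_exists:
  assumes "e = 2"
  shows "\<exists>P. ev4 (relation P) = 0"
proof -
  let ?f = "2 * q * z4 - y4 ^ 2"
  have "D ?f = 0"
    by (simp add: D_simps power2_eq_square D_y4[OF assms] D_z4[OF assms])
  moreover have "wt (int e + (- 2)) (q * z4)" by (rule wt_mult[OF wt_q wt_z4[OF assms]])
  then have "wt 0 (of_int 2 * (q * z4))" using assms by (intro wt_of_int_mult) simp
  then have "wt 0 ?f"
    using wt_mult[OF wt_y4[OF assms] wt_y4[OF assms]] wt_diff by (simp add: power2_eq_square mult.assoc)
  ultimately obtain P where "?f = poly (map_poly i P) p" using invariant_poly by blast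
  then show ?thesis by (intro exI[of _ P]) (simp add: relation_def ev4_simps mpol_eval_poly[OF i_hom] point4_simps)
qed

text \<open>
  The elements \<open>1, y, z, y z, z\<^sup>2, y z\<^sup>2, \<dots>\<close> have nilpotency degrees \<open>0, 1, 2, 3, 4, 5, \<dots>\<close>, so they are
  independent over \<open>ker D\<close>.
\<close>

lemma D_degree_basis4:
  assumes "e = 2"
  shows "D_degree j (z4 ^ (j div 2) * y4 ^ (j mod 2))"
proof -
  have "D_degree 2 z4" "D_degree 1 y4"
    using D_y4[OF assms] D_z4[OF assms] q_nonzero by (simp_all add: D_degree_def numeral_2_eq_2)
  then have "D_degree (j div 2 * 2 + j mod 2 * 1) (z4 ^ (j div 2) * y4 ^ (j mod 2))"
    by (intro D_degree_mult D_degree_power)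
  then show ?thesis by simp
qed

definition linear_in_Y :: "(4, 'k) mpol \<Rightarrow> bool" where
  "linear_in_Y r \<longleftrightarrow> (\<forall>m\<in>Poly_Mapping.keys r. Poly_Mapping.lookup m 1 \<le> 1)"

lemma linear_in_Y_ev4_eq_0:
  assumes "e = 2" "linear_in_Y r" "ev4 r = 0"
  shows "r = 0"
proof -
  let ?l = Poly_Mapping.lookup
  let ?J = "\<lambda>m :: 4 \<Rightarrow>\<^sub>0 nat. 2 * ?l m 2 + ?l m 1"
  have "?l r m = 0" if "m \<in> Poly_Mapping.keys r" for m
  proof (rule monomials_independent[OF _ _ D_degree_basis4[OF assms(1)] _ that])
    show "inj_on (\<lambda>m. (?l m 3, ?l m 0, ?J m)) (Poly_Mapping.keys r)"
    proof (rule inj_onI, rule poly_mapping_eqI)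
      fix m m' :: "4 \<Rightarrow>\<^sub>0 nat" and v :: 4
      assume m: "m \<in> Poly_Mapping.keys r" "m' \<in> Poly_Mapping.keys r"
        and eq: "(?l m 3, ?l m 0, ?J m) = (?l m' 3, ?l m' 0, ?J m')"
      have "?l m 1 \<le> 1" "?l m' 1 \<le> 1" using m assms(2) by (auto simp: linear_in_Y_def)
      moreover have "?J m = ?J m'" using eq by simp
      ultimately have "?l m 1 = ?l m' 1" "?l m 2 = ?l m' 2" by presburger+
      moreover have "v \<in> {0, 1, 2, 3}" using UNIV_I[of v] unfolding UNIV_4 .
      ultimately show "?l m v = ?l m' v" using eq by auto
    qed
    have basis: "z4 ^ (?J m div 2) * y4 ^ (?J m mod 2) = z4 ^ ?l m 2 * y4 ^ ?l m 1"
      if "m \<in> Poly_Mapping.keys r" for m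
    proof -
      have "?l m 1 \<le> 1" using that assms(2) by (simp add: linear_in_Y_def)
      then have "?J m div 2 = ?l m 2" "?J m mod 2 = ?l m 1" by presburger+
      then show ?thesis by (simp only:)
    qed
    have "(\<Sum>m\<in>Poly_Mapping.keys r. i (?l r m)
        * (p ^ ?l m 3 * q ^ ?l m 0 * (z4 ^ (?J m div 2) * y4 ^ (?J m mod 2)))) = ev4 r"
      unfolding mpol_eval_def monomial_value_def prod_4 point4_simps
    proof (rule sum.cong[OF refl])
      fix m assume m: "m \<in> Poly_Mapping.keys r"
      show "i (?l r m) * (p ^ ?l m 3 * q ^ ?l m 0 * (z4 ^ (?J m div 2) * y4 ^ (?J m mod 2)))
          = i (?l r m) * (q ^ ?l m 0 * y4 ^ ?l m 1 * z4 ^ ?l m 2 * p ^ ?l m 3)"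
        unfolding basis[OF m] by (simp only: mult_ac)
    qed
    then show "(\<Sum>m\<in>Poly_Mapping.keys r. i (?l r m)
        * (p ^ ?l m 3 * q ^ ?l m 0 * (z4 ^ (?J m div 2) * y4 ^ (?J m mod 2)))) = 0"
      using assms(3) by simp
  qed auto
  then show ?thesis
    by (intro poly_mapping_eqI) (metis lookup_zero in_keys_iff)
qed


text \<open>
  Division with remainder by the relation, which is monic in \<open>Y\<close> up to sign.
\<close>

lemma reduce_mod_relation: "\<exists>g s. linear_in_Y g \<and> r = g + relation P * s"
proof -
  let ?l = Poly_Mapping.lookup
  define Y_free where "Y_free r \<longleftrightarrow> (\<forall>m\<in>Poly_Mapping.keys r. ?l m 1 = 0)" for r :: "(4, 'k) mpol"
  define N where "N r \<longleftrightarrow> (\<exists>a b s. Y_free a \<and> Y_free b \<and> r = a + Var 1 * b + relation P * s)" for r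
  have NI: "N r" if "Y_free a" "Y_free b" "r = a + Var 1 * b + relation P * s" for r a b s
    using that unfolding N_def by blast
  have free_add: "Y_free (a + b)" if "Y_free a" "Y_free b" for a b
    using that keys_add[of a b] by (auto simp: Y_free_def)
  have free_mult: "Y_free (a * b)" if "Y_free a" "Y_free b" for a b
  proof -
    have "?l m 1 = 0" if m: "m \<in> Poly_Mapping.keys (a * b)" for m
    proof -
      obtain k k' where "k \<in> Poly_Mapping.keys a" "k' \<in> Poly_Mapping.keys b" "m = k + k'"
        using m keys_mult[of a b] by blast
      then show ?thesis using \<open>Y_free a\<close> \<open>Y_free b\<close> by (simp add: Y_free_def lookup_add)
    qed
    then show ?thesis by (simp add: Y_free_def)
  qed
  have free_Const: "Y_free (Const c)" for c
    by (simp add: Y_free_def Const_def)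
  have free_Var: "Y_free (Var v)" if "v \<noteq> 1" for v
    using that by (simp add: Y_free_def Var_def lookup_single)
  have free_0: "Y_free 0" by (simp add: Y_free_def)
  have free_poly: "Y_free (poly (map_poly Const P) (Var 3))"
    by (induction P) (use distinct_4 in \<open>auto simp: free_0 hom_map_poly[OF Const_hom]
        intro!: free_add free_mult free_Const free_Var\<close>)
  have free_2: "Y_free 2" using free_Const[of 2] by (simp add: is_hom_simps[OF Const_hom])
  define R :: "(4, 'k) mpol" where "R = 2 * Var 0 * Var 2 - poly (map_poly Const P) (Var 3)"
  have "R = 2 * Var 0 * Var 2 + Const (- 1) * poly (map_poly Const P) (Var 3)"
    by (simp add: R_def is_hom_simps[OF Const_hom])
  moreover have "Y_free (2 * Var 0 * Var 2 + Const (- 1) * poly (map_poly Const P) (Var 3))"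
    using distinct_4 by (intro free_add free_mult free_2 free_poly free_Const free_Var) auto
  ultimately have free_R: "Y_free R" by simp
  \<comment> \<open>modulo the relation, \<open>Y\<^sup>2\<close> is the \<open>Y\<close>-free polynomial \<open>R\<close>\<close>
  have Y2: "Var 1 * Var 1 = R - relation P"
    by (simp add: R_def relation_def power2_eq_square)
  have "N r"
  proof (induction r rule: mpol_induct)
    case (const c)
    show ?case by (rule NI[of "Const c" 0 _ 0]) (simp_all add: free_Const free_0)
  next
    case (add r r')
    then obtain a b s a' b' s' where *: "Y_free a" "Y_free b" "r = a + Var 1 * b + relation P * s"
      "Y_free a'" "Y_free b'" "r' = a' + Var 1 * b' + relation P * s'" unfolding N_def by blast
    have "r + r' = (a + a') + Var 1 * (b + b') + relation P * (s + s')"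
      unfolding *(3,6) by (simp add: algebra_simps)
    then show ?case by (rule NI[OF free_add[OF *(1,4)] free_add[OF *(2,5)]])
  next
    case (var v r)
    then obtain a b s where *: "Y_free a" "Y_free b" "r = a + Var 1 * b + relation P * s"
      unfolding N_def by blast
    show ?case
    proof (cases "v = 1")
      case True
      have "Var v * r = Var 1 * a + (Var 1 * Var 1) * b + relation P * (Var 1 * s)"
        unfolding *(3) True by (simp add: algebra_simps)
      also have "\<dots> = R * b + Var 1 * a + relation P * (Var 1 * s - b)"
        unfolding Y2 by (simp add: algebra_simps)
      finally show ?thesis by (rule NI[OF free_mult[OF free_R *(2)] *(1)])
    next
      case False
      have "Var v * r = Var v * a + Var 1 * (Var v * b) + relation P * (Var v * s)"
        unfolding *(3) by (simp add: algebra_simps)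
      then show ?thesis by (rule NI[OF free_mult[OF free_Var[OF False] *(1)] free_mult[OF free_Var[OF False] *(2)]])
    qed
  qed
  then obtain a b s where ab: "Y_free a" "Y_free b" "r = a + Var 1 * b + relation P * s"
    unfolding N_def by blast
  have "linear_in_Y (a + Var 1 * b)"
    unfolding linear_in_Y_def
  proof
    fix m assume "m \<in> Poly_Mapping.keys (a + Var 1 * b)"
    then consider "m \<in> Poly_Mapping.keys a" | "m \<in> Poly_Mapping.keys (Var 1 * b)"
      using keys_add[of a "Var 1 * b"] by blast
    then show "?l m 1 \<le> 1"
    proof cases
      case 1
      then show ?thesis using ab(1) by (simp add: Y_free_def)
    next
      case 2
      then obtain k k' where "k \<in> Poly_Mapping.keys (Var 1 :: (4, 'k) mpol)" "k' \<in> Poly_Mapping.keys b" "m = k + k'"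
        using keys_mult[of "Var 1" b] by blast
      then show ?thesis using ab(2) by (simp add: Y_free_def lookup_add Var_def)
    qed
  qed
  then show ?thesis using ab(3) by blast
qed

text \<open>
  The remainder of \<open>r\<close> modulo the relation has the same value as \<open>r\<close>, and a remainder of value 0
  vanishes.
\<close>

lemma kernel_ev4:
  assumes "e = 2" "ev4 (relation P) = 0"
  shows "ev4 r = 0 \<longleftrightarrow> r \<in> relation_ideal P"
proof -
  have ideal: "relation_ideal P = {s * relation P | s. True}"
    by (auto simp: relation_ideal_def relation_def cgenideal_def ring_of_type_algebra_def)
  show ?thesis
  proof
    assume r: "ev4 r = 0"
    obtain g s where g: "linear_in_Y g" "r = g + relation P * s" using reduce_mod_relation by blast
    then have "ev4 g = 0" using r assms(2) by (simp add: ev4_simps)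
    then have "g = 0" by (rule linear_in_Y_ev4_eq_0[OF assms(1) g(1)])
    then show "r \<in> relation_ideal P" using g(2) by (auto simp: ideal mult.commute)
  next
    assume "r \<in> relation_ideal P"
    then show "ev4 r = 0" using assms(2) by (auto simp: ideal ev4_simps)
  qed
qed

definition model_iso :: "(4, 'k) mpol set \<Rightarrow> 'b" where
  "model_iso C = the_elem (ev4 ` C)"

lemma model4:
  assumes e: "e = 2" and rel: "ev4 (relation P) = 0"
  shows "model_iso \<in> alg_iso (model_ring P) (model_const P) type_ring i"
    "transport (model_ring P) model_iso (induced (relation_ideal P) D4) = D"
    "transport (model_ring P) model_iso (induced (relation_ideal P) U4) = U"
proof -
  let ?R = "type_ring :: (4, 'k) mpol ring" and ?I = "relation_ideal P"
  have hom: "ring_hom_ring ?R (type_ring :: 'b ring) ev4"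
    using ev4_hom by (intro ring_hom_ringI2 ring_from_type_algebra) (simp add: is_hom_type_ring)
  have ker: "a_kernel ?R (type_ring :: 'b ring) ev4 = ?I"
    unfolding a_kernel_def' using kernel_ev4[OF e rel] by (auto simp: ring_of_type_algebra_def)
  have "ev4 ` carrier ?R = carrier (type_ring :: 'b ring)"
    using surj_ev4[OF e] by (simp add: ring_of_type_algebra_def)
  then have iso: "model_iso \<in> ring_iso (model_ring P) type_ring"
    using ring_hom_ring.FactRing_iso_set[OF hom] by (simp add: ker model_ring_def model_iso_def[abs_def])
  have coset: "?I +>\<^bsub>?R\<^esub> r = {s. ev4 s = ev4 r}" for r
  proof -
    have "?I +>\<^bsub>?R\<^esub> r = {t + r | t. t \<in> ?I}"
      by (auto simp: a_r_coset_def r_coset_def ring_of_type_algebra_def)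
    also have "\<dots> = {s. s - r \<in> ?I}" by (auto, metis diff_add_cancel)
    also have "\<dots> = {s. ev4 s = ev4 r}" by (simp flip: kernel_ev4[OF e rel] add: ev4_simps)
    finally show ?thesis .
  qed
  have map_coset: "model_iso {s. ev4 s = b} = b" for b
  proof -
    obtain r where "b = ev4 r" using surj_ev4[OF e] by (metis surj_def)
    then have "ev4 ` {s. ev4 s = b} = {b}" by auto
    then show ?thesis by (simp add: model_iso_def)
  qed
  have "model_iso (model_const P c) = i c" for c
    unfolding model_const_def coset map_coset by (rule mpol_eval_Const[OF i_hom])
  then show "model_iso \<in> alg_iso (model_ring P) (model_const P) type_ring i"
    using iso by (simp add: alg_iso_def)
  have transport: "transport (model_ring P) model_iso (induced ?I F) = G"
    if F: "\<And>r. ev4 (F r) = G (ev4 r)" for F G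
  proof
    fix b
    have bij: "bij_betw model_iso (carrier (model_ring P)) UNIV"
      using iso by (simp add: ring_iso_def) (simp add: ring_of_type_algebra_def)
    let ?C = "inv_into (carrier (model_ring P)) model_iso b"
    have "?C \<in> carrier (model_ring P)" "model_iso ?C = b"
      using bij by (auto simp: bij_betw_def intro: inv_into_into f_inv_into_f)
    then obtain r where "?C = ?I +>\<^bsub>?R\<^esub> r"
      by (auto simp: model_ring_def FactRing_def A_RCOSETS_def')
    then have C: "?C = {s. ev4 s = b}" using \<open>model_iso ?C = b\<close> by (simp add: coset map_coset)
    obtain r where "ev4 r = b" using surj_ev4[OF e] by (metis surj_def)
    then have "induced ?I F ?C = {s. ev4 s = G b}"
      unfolding induced_def coset C by (auto simp: F)
    then show "transport (model_ring P) model_iso (induced ?I F) b = G b"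
      by (simp add: transport_def map_coset)
  qed
  show "transport (model_ring P) model_iso (induced ?I D4) = D"
    "transport (model_ring P) model_iso (induced ?I U4) = U"
    by (rule transport, rule D_ev4[OF e]) (rule transport, rule U_ev4[OF e])
qed

text \<open>
  The derivation \<open>X \<partial>/\<partial>W + (P'(W) / 2) \<partial>/\<partial>Z\<close> kills the relation, so it descends to \<open>B\<close>; it is
  triangular and hence locally nilpotent, and it maps \<open>p\<close> to \<open>q\<close>.
\<close>

lemma makar_limanov4:
  assumes e: "e = 2" and rel: "ev4 (relation P) = 0"
  shows "(makar_limanov :: 'b set) = range i"
proof -
  define g where "g = poly (map_poly Const (smult (1 / 2) (pderiv P))) (Var 3 :: (4, 'k) mpol)"
  define E where "E r = Var 0 * partial 3 r + g * partial 2 r" for r :: "(4, 'k) mpol"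
  have E: "derivation E"
    unfolding derivation_def E_def
    by (simp add: derivation_simps(1,2)[OF partial_derivation] algebra_simps)
  note Es = derivation_simps[OF E]
  have E_Const: "E (Const c) = 0" for c by (simp add: E_def partial_Const)
  have E_Var: "E (Var 0) = 0" "E (Var 1) = 0" "E (Var 2) = g" "E (Var 3) = Var 0"
    using distinct_4 distinct_4[symmetric] by (simp_all add: E_def partial_Var)
  have "2 * g = poly (map_poly Const (smult 2 (smult (1 / 2) (pderiv P)))) (Var 3)"
    unfolding g_def hom_map_poly(4)[OF Const_hom, of 2] by (simp add: is_hom_simps[OF Const_hom])
  then have g2: "2 * g = poly (map_poly Const (pderiv P)) (Var 3)" by simp
  have "E (relation P) = Var 0 * (2 * g) - poly (map_poly Const (pderiv P)) (Var 3) * Var 0"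
    unfolding relation_def Es derivation_poly[OF E Const_hom E_Const] power2_eq_square E_Var
    by (simp add: Es E_Var algebra_simps)
  then have E_rel: "E (relation P) = 0" unfolding g2 by (simp add: mult.commute)
  obtain F where F: "derivation F" "\<And>r. F (ev4 r) = ev4 (E r)"
  proof (rule induced_derivation[OF ev4_hom surj_ev4[OF e] E])
    fix r assume "ev4 r = 0"
    then obtain s where "r = s * relation P"
      using kernel_ev4[OF e rel, of r]
      by (auto simp: relation_ideal_def relation_def cgenideal_def ring_of_type_algebra_def)
    then show "ev4 (E r) = 0" by (simp add: Es E_rel ev4_simps rel)
  qed blast
  note Fs = derivation_simps[OF F(1)]
  have Fi: "F (i c) = 0" for c
    using F(2)[of "Const c"] by (simp add: E_Const ev4_simps)
  have F_point: "F q = 0" "F y4 = 0" "F z4 = ev4 g" "F p = q"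
    using F(2)[of "Var 0"] F(2)[of "Var 1"] F(2)[of "Var 2"] F(2)[of "Var 3"]
    by (simp_all add: E_Var ev4_simps point4_simps)
  have nil_p: "(F ^^ 2) p = 0" "(F ^^ 1) q = 0" "(F ^^ 1) y4 = 0"
    by (simp_all add: numeral_2_eq_2 F_point)
  have "\<exists>n. (F ^^ n) (mpol_eval i (\<lambda>_ :: 4. p) r) = 0" for r
    by (rule locally_nilpotent_generators[OF F(1) i_hom Fi]) (use nil_p(1) in blast)
  moreover have "ev4 g = mpol_eval i (\<lambda>_ :: 4. p) g"
  proof -
    have "mpol_eval i x g = poly (map_poly i (smult (1 / 2) (pderiv P))) (x 3)" for x
      by (simp add: g_def mpol_eval_poly[OF i_hom] mpol_eval_Var[OF i_hom])
    then show ?thesis by (simp add: point4_simps)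
  qed
  ultimately obtain n where "(F ^^ n) (F z4) = 0" by (auto simp: F_point)
  then have nil_z: "(F ^^ Suc n) z4 = 0" by (simp add: funpow_swap1)
  have nil: "\<exists>n. (F ^^ n) (point4 v) = 0" for v
  proof -
    consider "v = 0" | "v = 1" | "v = 2" | "v = 3" using UNIV_I[of v] unfolding UNIV_4 by blast
    then show ?thesis
    proof cases
      case 1 show ?thesis using nil_p(2) unfolding 1 point4_simps by blast
    next
      case 2 show ?thesis using nil_p(3) unfolding 2 point4_simps by blast
    next
      case 3 show ?thesis using nil_z unfolding 3 point4_simps by blast
    next
      case 4 show ?thesis using nil_p(1) unfolding 4 point4_simps by blast
    qed
  qed
  have "\<exists>n. (F ^^ n) b = 0" for b
  proof -
    obtain r where "b = ev4 r" using surj_ev4[OF e] by (metis surj_def)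
    then show ?thesis using locally_nilpotent_generators[OF F(1) i_hom Fi, of point4, OF nil] by blast
  qed
  then have "F \<in> LND" using F(1) by (simp add: LND_def)
  moreover have "F p \<noteq> 0" using q_nonzero by (simp add: F_point)
  ultimately show ?thesis by (rule makar_limanov_eq)
qed

end

theorem proposition6p2:
  fixes i :: "'k::field_char_0 \<Rightarrow> 'b::idom"
    and D U :: "'b \<Rightarrow> 'b"
  assumes "affine_UFD i"
    and "fundamental_pair D U"
    and "\<not> trivial_pair D U"
    and "Ker D \<inter> Ker U \<noteq> range i"
    and "\<exists>h. h \<in> alg_iso (type_ring\<lparr>carrier := Ker D\<rparr>) i (type_ring :: (2, 'k) mpol ring) Const"
  shows "((\<exists>h. h \<in> alg_iso (type_ring :: (3, 'k) mpol ring) Const type_ring i \<and>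
              pair_equiv i (D, U) (transport type_ring h D3, transport type_ring h U3))
          \<or> (\<exists>P :: 'k poly. \<exists>h. h \<in> alg_iso (model_ring P) (model_const P) type_ring i \<and>
              pair_equiv i (D, U)
                (transport (model_ring P) h (induced (relation_ideal P) D4),
                 transport (model_ring P) h (induced (relation_ideal P) U4))))
         \<and> (makar_limanov :: 'b set) = range i"
proof -
  obtain h where h: "h \<in> alg_iso (type_ring\<lparr>carrier := Ker D\<rparr>) i (type_ring :: (2, 'k) mpol ring) Const"
    using assms(5) by blast
  have "is_hom i" and UFD: "factorial_domain (type_ring :: 'b ring)"
    using assms(1) by (simp_all add: affine_UFD_def is_hom_type_ring)
  then interpret sl2_plane i D U h
    using assms(2) h by unfold_locales
  obtain p q e where "graded_plane i D U p q e"
    using graded_plane_exists[OF UFD assms(3,4)] by blast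
  then interpret graded_plane i D U p q e .
  have refl: "pair_equiv i (D, U) (D, U)" by (simp add: pair_equiv_def)
  consider "e = 1" | "e = 2" using e_le_2 e_pos by linarith
  then show ?thesis
  proof cases
    case 1
    then show ?thesis using model3[OF 1] refl by metis
  next
    case 2
    obtain P where "ev4 (relation P) = 0" using relation_exists[OF 2] by blast
    then show ?thesis using model4[OF 2] makar_limanov4[OF 2] refl by metis
  qed
qed

end
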